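(* There exist a compact complex torus $T$ equipped with a flat hermitian metric $h$, and open subsets $\Omega_2\subset\Omega_1\subset T$, such that: (1) $\Omega_2$ is not dense in $\Omega_1$, and $\Omega_1$ is not dense in $T$. (2) For every point $p\in\Omega_1$ and every tangent vector $v\in T_p\Omega_1$ there is a non-constant holomorphic map $f:\mathbb{C}\to\Omega_1$ with $f(0)=p$, $f'(0)=v$ and $\overline{f(\mathbb{C})}=\overline{\Omega_1}$. (3) If $f:\mathbb{C}\to T$ is a non-constant holomorphic map with bounded derivative (with respect to the euclidean metric on $\mathbb{C}$ and $h$ on $T$) and $f(\mathbb{C})\subset\overline{\Omega_1}$, then $f(\mathbb{C})\subset\overline{\Omega_2}$. Moreover, $f$ is affine-linear and $\overline{f(\mathbb{C})}$ is a closed analytic subset of $T$.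
   Context: A compact complex torus is $T=\mathbb{C}^n/\Lambda$ with $\Lambda\subset\mathbb{C}^n$ a lattice (discrete subgroup of rank $2n$); a flat hermitian metric on it is one induced by the euclidean metric on $\mathbb{C}^n$. The tangent space $T_pT$ is the holomorphic tangent space, identified with $\mathbb{C}^n$. A holomorphic map $f:\mathbb{C}\to T$ has bounded derivative if there is a constant $C>0$ such that $\|Df_z\|<C$ for all $z\in\mathbb{C}$, the norm being taken with respect to the euclidean metric on $\mathbb{C}$ and $h$ on $T$. A map $f:\mathbb{C}\to T=\mathbb{C}^n/\Lambda$ is called affine-linear if it is the composition of an affine-linear map $\mathbb{C}\to\mathbb{C}^n$ with the projection $\mathbb{C}^n\to T$. All closures are taken in $T$ with respect to the usual (manifold) topology. *)

theory Defs
  imports "HOL-Analysis.Analysis"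
begin

text \<open>
  The dimension of the torus is existentially quantified, so \<open>\<complex>\<^sup>n\<close> is modelled on an
  explicit carrier: sequences vanishing from index \<open>n\<close> on. As a subspace of
  \<^typ>\<open>nat \<Rightarrow> complex\<close> with the product topology it carries the usual topology of \<open>\<complex>\<^sup>n\<close>.
  The library distance on \<^typ>\<open>nat \<Rightarrow> complex\<close> is not the euclidean one and is not used.
\<close>

type_synonym cvec = "nat \<Rightarrow> complex"

definition Cn :: "nat \<Rightarrow> cvec set" where
  "Cn n = {x. \<forall>i\<ge>n. x i = 0}"

definition Cn_inner :: "nat \<Rightarrow> cvec \<Rightarrow> cvec \<Rightarrow> complex" where
  "Cn_inner n u v = (\<Sum>i<n. u i * cnj (v i))"

definition Cn_norm :: "nat \<Rightarrow> cvec \<Rightarrow> real" where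
  "Cn_norm n u = sqrt (Re (Cn_inner n u u))"

text \<open>Complex (Frechet) differentiability at every point; \<open>V\<close> is meant to be open in \<open>Cn n\<close>.\<close>

definition Cn_holomorphic_on :: "nat \<Rightarrow> (cvec \<Rightarrow> complex) \<Rightarrow> cvec set \<Rightarrow> bool" where
  "Cn_holomorphic_on n F V \<longleftrightarrow>
     (\<forall>x\<in>V. \<exists>L::cvec. \<forall>e>0. \<exists>d>0. \<forall>y\<in>V. Cn_norm n (\<lambda>i. y i - x i) < d \<longrightarrow>
        cmod (F y - F x - (\<Sum>i<n. L i * (y i - x i))) \<le> e * Cn_norm n (\<lambda>i. y i - x i))"

text \<open>\<open>b\<close> induces a group isomorphism from \<open>\<int>\<^sup>k\<close> onto \<open>\<Lambda>\<close>.\<close>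

definition Z_basis :: "nat \<Rightarrow> (nat \<Rightarrow> cvec) \<Rightarrow> cvec set \<Rightarrow> bool" where
  "Z_basis k b \<Lambda> \<longleftrightarrow>
     bij_betw (\<lambda>(c::nat \<Rightarrow> int) i. \<Sum>j<k. of_int (c j) * b j i) ({..<k} \<rightarrow>\<^sub>E UNIV) \<Lambda>"

definition complex_lattice :: "nat \<Rightarrow> cvec set \<Rightarrow> bool" where
  "complex_lattice n \<Lambda> \<longleftrightarrow>
     \<Lambda> \<subseteq> Cn n \<and>
     (\<lambda>_. 0) \<in> \<Lambda> \<and> (\<forall>x\<in>\<Lambda>. \<forall>y\<in>\<Lambda>. (\<lambda>i. x i - y i) \<in> \<Lambda>) \<and>
     discrete \<Lambda> \<and>
     (\<exists>b. Z_basis (2 * n) b \<Lambda>)"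

definition torus_proj :: "cvec set \<Rightarrow> cvec \<Rightarrow> cvec set" where
  "torus_proj \<Lambda> x = (\<lambda>l i. x i + l i) ` \<Lambda>"

definition torus :: "nat \<Rightarrow> cvec set \<Rightarrow> cvec set set" where
  "torus n \<Lambda> = torus_proj \<Lambda> ` Cn n"

text \<open>The quotient topology.\<close>

definition torus_topology :: "nat \<Rightarrow> cvec set \<Rightarrow> cvec set topology" where
  "torus_topology n \<Lambda> = topology (\<lambda>U. U \<subseteq> torus n \<Lambda> \<and>
     openin (top_of_set (Cn n)) {x \<in> Cn n. torus_proj \<Lambda> x \<in> U})"

lemma openin_torus_topology:
  "openin (torus_topology n \<Lambda>) U \<longleftrightarrow>
     U \<subseteq> torus n \<Lambda> \<and> openin (top_of_set (Cn n)) {x \<in> Cn n. torus_proj \<Lambda> x \<in> U}"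
proof -
  have "istopology (\<lambda>U. U \<subseteq> torus n \<Lambda> \<and>
     openin (top_of_set (Cn n)) {x \<in> Cn n. torus_proj \<Lambda> x \<in> U})" (is "istopology ?P")
    unfolding istopology_def
  proof (intro conjI allI impI)
    fix S T assume S: "?P S" and T: "?P T"
    show "S \<inter> T \<subseteq> torus n \<Lambda>" using S by blast
    have eq: "{x \<in> Cn n. torus_proj \<Lambda> x \<in> S \<inter> T} =
        {x \<in> Cn n. torus_proj \<Lambda> x \<in> S} \<inter> {x \<in> Cn n. torus_proj \<Lambda> x \<in> T}" by blast
    show "openin (top_of_set (Cn n)) {x \<in> Cn n. torus_proj \<Lambda> x \<in> S \<inter> T}"
      unfolding eq using S T by (intro openin_Int) simp_all
  next
    fix K assume K: "\<forall>S\<in>K. ?P S"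
    show "\<Union>K \<subseteq> torus n \<Lambda>" using K by blast
    have eq: "{x \<in> Cn n. torus_proj \<Lambda> x \<in> \<Union>K} = (\<Union>S\<in>K. {x \<in> Cn n. torus_proj \<Lambda> x \<in> S})" by blast
    show "openin (top_of_set (Cn n)) {x \<in> Cn n. torus_proj \<Lambda> x \<in> \<Union>K}"
      unfolding eq using K by (intro openin_Union) auto
  qed
  from topology_inverse'[OF this] show ?thesis
    by (simp only: torus_topology_def)
qed

lemma topspace_torus_topology: "topspace (torus_topology n \<Lambda>) = torus n \<Lambda>"
proof -
  have "{x \<in> Cn n. torus_proj \<Lambda> x \<in> torus n \<Lambda>} = Cn n"
    by (auto simp: torus_def)
  then have "openin (torus_topology n \<Lambda>) (torus n \<Lambda>)"
    by (simp add: openin_torus_topology)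
  then show ?thesis
    by (meson openin_subset openin_topspace openin_torus_topology subset_antisym)
qed

text \<open>
  All tangent spaces of the torus are identified with \<open>Cn n\<close> through the differential of the
  projection; \<open>h p\<close> is the hermitian form on the tangent space at \<open>p\<close>.
\<close>

definition flat_hermitian_metric ::
    "nat \<Rightarrow> cvec set \<Rightarrow> (cvec set \<Rightarrow> cvec \<Rightarrow> cvec \<Rightarrow> complex) \<Rightarrow> bool" where
  "flat_hermitian_metric n \<Lambda> h \<longleftrightarrow>
     (\<forall>x\<in>Cn n. \<forall>u\<in>Cn n. \<forall>v\<in>Cn n. h (torus_proj \<Lambda> x) u v = Cn_inner n u v)"

text \<open>
  The local inverses of the projection are the charts of the torus, so a map \<open>f\<close> into the torus is
  holomorphic near a point iff it has a holomorphic lift to \<open>\<complex>\<^sup>n\<close> there, and its derivative is that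
  of such a lift.
\<close>

definition holomorphic_lift ::
    "nat \<Rightarrow> cvec set \<Rightarrow> (complex \<Rightarrow> cvec set) \<Rightarrow> complex set \<Rightarrow> (complex \<Rightarrow> cvec) \<Rightarrow> bool" where
  "holomorphic_lift n \<Lambda> f U g \<longleftrightarrow>
     open U \<and> g ` U \<subseteq> Cn n \<and> (\<forall>i. (\<lambda>z. g z i) holomorphic_on U) \<and>
     (\<forall>z\<in>U. f z = torus_proj \<Lambda> (g z))"

definition torus_holomorphic :: "nat \<Rightarrow> cvec set \<Rightarrow> (complex \<Rightarrow> cvec set) \<Rightarrow> bool" where
  "torus_holomorphic n \<Lambda> f \<longleftrightarrow> (\<forall>z. \<exists>U g. z \<in> U \<and> holomorphic_lift n \<Lambda> f U g)"

definition has_torus_derivative ::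
    "nat \<Rightarrow> cvec set \<Rightarrow> (complex \<Rightarrow> cvec set) \<Rightarrow> cvec \<Rightarrow> complex \<Rightarrow> bool" where
  "has_torus_derivative n \<Lambda> f v z \<longleftrightarrow>
     (\<exists>U g. z \<in> U \<and> holomorphic_lift n \<Lambda> f U g \<and>
        (\<forall>i. ((\<lambda>w. g w i) has_field_derivative v i) (at z)))"

text \<open>
  The differential at \<open>z\<close> is \<open>t \<mapsto> t v\<close> with \<open>v = f' z\<close>, so its operator norm is the length of \<open>v\<close>
  with respect to \<open>h\<close> at \<open>f z\<close>.
\<close>

definition bounded_torus_derivative ::
    "nat \<Rightarrow> cvec set \<Rightarrow> (cvec set \<Rightarrow> cvec \<Rightarrow> cvec \<Rightarrow> complex) \<Rightarrow> (complex \<Rightarrow> cvec set) \<Rightarrow> bool" where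
  "bounded_torus_derivative n \<Lambda> h f \<longleftrightarrow>
     (\<exists>C>0. \<forall>z. \<exists>v. has_torus_derivative n \<Lambda> f v z \<and> sqrt (Re (h (f z) v v)) < C)"

definition torus_affine_linear :: "nat \<Rightarrow> cvec set \<Rightarrow> (complex \<Rightarrow> cvec set) \<Rightarrow> bool" where
  "torus_affine_linear n \<Lambda> f \<longleftrightarrow>
     (\<exists>a\<in>Cn n. \<exists>b\<in>Cn n. \<forall>z. f z = torus_proj \<Lambda> (\<lambda>i. a i + z * b i))"

definition torus_holomorphic_fun_on ::
    "nat \<Rightarrow> cvec set \<Rightarrow> (cvec set \<Rightarrow> complex) \<Rightarrow> cvec set set \<Rightarrow> bool" where
  "torus_holomorphic_fun_on n \<Lambda> \<phi> U \<longleftrightarrow>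
     Cn_holomorphic_on n (\<lambda>x. \<phi> (torus_proj \<Lambda> x)) {x \<in> Cn n. torus_proj \<Lambda> x \<in> U}"

definition torus_closed_analytic :: "nat \<Rightarrow> cvec set \<Rightarrow> cvec set set \<Rightarrow> bool" where
  "torus_closed_analytic n \<Lambda> A \<longleftrightarrow>
     closedin (torus_topology n \<Lambda>) A \<and>
     (\<forall>p\<in>torus n \<Lambda>. \<exists>U k (\<phi>::nat \<Rightarrow> cvec set \<Rightarrow> complex).
        openin (torus_topology n \<Lambda>) U \<and> p \<in> U \<and>
        (\<forall>j<k. torus_holomorphic_fun_on n \<Lambda> (\<phi> j) U) \<and>
        A \<inter> U = {q \<in> U. \<forall>j<k. \<phi> j q = 0})"

end

theory Submission
  imports Defs "HOL-Complex_Analysis.Complex_Analysis"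
    "HOL-Computational_Algebra.Fundamental_Theorem_Algebra"
begin

text \<open>
  On \<open>T = E \<times> E\<close> with \<open>E = \<complex> / \<int>[\<i>]\<close> and coordinates \<open>(z, w)\<close>, let \<open>\<Omega>\<^sub>1\<close> consist of the points such that
  \<open>w\<close> lies in a small open disc \<open>D\<^sub>j\<close> whenever \<open>z\<close> lies in a closed disc \<open>\<Delta>\<^sub>j\<close>, for \<open>j = 1, 2\<close>, where
  \<open>\<Delta>\<^sub>1, \<Delta>\<^sub>2\<close> and \<open>D\<^sub>1, D\<^sub>2\<close> are centred at \<open>0, 1/2\<close>; and let \<open>\<Omega>\<^sub>2\<close> be the part of \<open>\<Omega>\<^sub>1\<close> with \<open>z\<close> outside
  both \<open>\<Delta>\<^sub>j\<close>.

  By Liouville's theorem a curve with bounded derivative is affine-linear. A non-vertical affine line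
  in the closure of \<open>\<Omega>\<^sub>1\<close> must be horizontal: its slope times any Gaussian integer stays near the
  lattice. A horizontal line would meet both \<open>D\<^sub>1\<close> and \<open>D\<^sub>2\<close>, which are disjoint. So only the vertical
  curves \<open>{z} \<times> E\<close> over the closure of the complement of the \<open>\<Delta>\<^sub>j\<close> remain.

  Entire curves without a bound on the derivative are flexible: the preimage of the \<open>\<Delta>\<^sub>j\<close> in \<open>\<complex>\<close> is a
  locally finite union of disjoint discs, on which an entire function can be prescribed up to
  arbitrarily small errors (a case of Arakelyan's theorem), with freedom left to make the graph dense.
\<close>

section \<open>Approximation by entire functions on compact sets with connected complement\<close>

text \<open>A single pair of discs would not do: the horizontal curve through the centre of
  \<open>D\<close> would be affine, lie in \<open>Omega1\<close> and leave the closure of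
  \<open>Omega2\<close>. The second pair contradicts the first on every horizontal line. Closed
  discs in the base with open discs in the fibre make \<open>Omega1\<close> open. The dense curve is
  built in C^2. Dense data accumulate in the torus, but lifted over different integer translates
  \<open>\<zeta> k + k\<close> of the base coordinate they become locally finite, so the
  prescriptions do not interfere. Each is a constant on a disc or at a point, so it suffices to have
  entire functions close to 1 on one disc and close to 0 on a compact set. The obstacle is the
  first-order data at 0: \<open>v\<close> is arbitrary, possibly vertical or zero, so the base
  coordinate may have to be critical at 0 and still be onto; and forcing the second component of the
  derivative adds a term with a factor \<open>t\<close> that must stay within the tolerance on every
  disc.\<close>

definition entire_approx :: "complex set \<Rightarrow> (complex \<Rightarrow> complex) \<Rightarrow> bool" where
  "entire_approx K f \<longleftrightarrow>
     (\<forall>e>0. \<exists>p. p holomorphic_on UNIV \<and> (\<forall>z\<in>K. cmod (f z - p z) < e))"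

lemma entire_approx_entire: "p holomorphic_on UNIV \<Longrightarrow> entire_approx K p"
  unfolding entire_approx_def by force

lemma entire_approx_limit:
  assumes "\<And>e. e > 0 \<Longrightarrow> \<exists>g. entire_approx K g \<and> (\<forall>z\<in>K. cmod (f z - g z) < e)"
  shows "entire_approx K f"
  unfolding entire_approx_def
proof (intro allI impI)
  fix e :: real assume "e > 0"
  then obtain g where g: "entire_approx K g" "\<forall>z\<in>K. cmod (f z - g z) < e/2"
    using assms[of "e/2"] by auto
  then obtain p where p: "p holomorphic_on UNIV" "\<forall>z\<in>K. cmod (g z - p z) < e/2"
    unfolding entire_approx_def using \<open>e > 0\<close> half_gt_zero by blast
  have "cmod (f z - p z) < e" if "z \<in> K" for z
    using norm_triangle_lt[of "f z - g z" "g z - p z" e] g(2) p(2) that by force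
  then show "\<exists>p. p holomorphic_on UNIV \<and> (\<forall>z\<in>K. cmod (f z - p z) < e)"
    using p(1) by blast
qed

lemma entire_approx_bounded:
  assumes "compact K" "entire_approx K f"
  obtains B where "B > 0" "\<And>z. z \<in> K \<Longrightarrow> cmod (f z) \<le> B"
proof -
  obtain p where p: "p holomorphic_on UNIV" "\<forall>z\<in>K. cmod (f z - p z) < 1"
    using assms(2) unfolding entire_approx_def using zero_less_one by blast
  have "compact (p ` K)"
    using assms(1) p(1)
    by (meson compact_continuous_image continuous_on_subset holomorphic_on_imp_continuous_on top_greatest)
  then have "bounded (p ` K)" by (rule compact_imp_bounded)
  then obtain B where B: "B > 0" "\<And>z. z \<in> K \<Longrightarrow> cmod (p z) \<le> B"
    unfolding bounded_pos by auto
  have "cmod (f z) \<le> B + 1" if "z \<in> K" for z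
    using norm_triangle_ineq[of "f z - p z" "p z"] p(2) B(2)[OF that] that by force
  then show thesis using that[of "B+1"] B(1) by auto
qed

lemma entire_approx_add:
  assumes "entire_approx K f" "entire_approx K g"
  shows "entire_approx K (\<lambda>z. f z + g z)"
  unfolding entire_approx_def
proof (intro allI impI)
  fix e :: real assume "e > 0"
  then have e2: "e/2 > 0" by simp
  obtain p where p: "p holomorphic_on UNIV" "\<forall>z\<in>K. cmod (f z - p z) < e/2"
    using assms(1) e2 unfolding entire_approx_def by blast
  obtain q where q: "q holomorphic_on UNIV" "\<forall>z\<in>K. cmod (g z - q z) < e/2"
    using assms(2) e2 unfolding entire_approx_def by blast
  have "cmod (f z + g z - (p z + q z)) < e" if "z \<in> K" for z
    using norm_triangle_lt[of "f z - p z" "g z - q z" e] p(2) q(2) that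
    by (force simp: algebra_simps)
  then show "\<exists>p. p holomorphic_on UNIV \<and> (\<forall>z\<in>K. cmod (f z + g z - p z) < e)"
    using p(1) q(1) by (intro exI[of _ "\<lambda>z. p z + q z"]) (auto intro: holomorphic_intros)
qed

lemma entire_approx_mult:
  assumes "compact K" "entire_approx K f" "entire_approx K g"
  shows "entire_approx K (\<lambda>z. f z * g z)"
  unfolding entire_approx_def
proof (intro allI impI)
  fix e :: real assume "e > 0"
  obtain A where A: "A > 0" "\<And>z. z \<in> K \<Longrightarrow> cmod (f z) \<le> A"
    using entire_approx_bounded assms by blast
  have "e / (2 * A) > 0" using A \<open>e > 0\<close> by simp
  then obtain q where q: "q holomorphic_on UNIV" "\<forall>z\<in>K. cmod (g z - q z) < e / (2 * A)"
    using assms(3) unfolding entire_approx_def by blast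
  \<comment> \<open>The bound is on the approximant \<open>q\<close> rather than on
    \<open>g\<close>, so \<open>q\<close> has to be fixed before the accuracy of \<open>p\<close>
    can be chosen.\<close>
  obtain B where B: "B > 0" "\<And>z. z \<in> K \<Longrightarrow> cmod (q z) \<le> B"
    using entire_approx_bounded[OF assms(1) entire_approx_entire[OF q(1)]] by blast
  have "e / (2 * B) > 0" using B \<open>e > 0\<close> by simp
  then obtain p where p: "p holomorphic_on UNIV" "\<forall>z\<in>K. cmod (f z - p z) < e / (2 * B)"
    using assms(2) unfolding entire_approx_def by blast
  have "cmod (f z * g z - p z * q z) < e" if "z \<in> K" for z
  proof -
    have "cmod (f z * (g z - q z)) \<le> A * cmod (g z - q z)"
      using A(2)[OF that] by (simp add: norm_mult mult_right_mono)
    also have "\<dots> < A * (e / (2 * A))"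
      using q(2) that A(1) by (intro mult_strict_left_mono) auto
    finally have 1: "cmod (f z * (g z - q z)) < e / 2" using A by simp
    have "cmod ((f z - p z) * q z) \<le> cmod (f z - p z) * B"
      using B(2)[OF that] by (simp add: norm_mult mult_left_mono)
    also have "\<dots> < (e / (2 * B)) * B"
      using p(2) that B(1) by (intro mult_strict_right_mono) auto
    finally have 2: "cmod ((f z - p z) * q z) < e / 2" using B by simp
    have "f z * g z - p z * q z = f z * (g z - q z) + (f z - p z) * q z"
      by (simp add: algebra_simps)
    then show ?thesis
      using norm_triangle_ineq[of "f z * (g z - q z)" "(f z - p z) * q z"] 1 2 by simp
  qed
  then show "\<exists>p. p holomorphic_on UNIV \<and> (\<forall>z\<in>K. cmod (f z * g z - p z) < e)"
    using p(1) q(1) by (intro exI[of _ "\<lambda>z. p z * q z"]) (auto intro: holomorphic_intros)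
qed

lemma entire_approx_cmult:
  assumes "compact K" "entire_approx K f"
  shows "entire_approx K (\<lambda>z. c * f z)"
  using entire_approx_mult[OF assms(1) entire_approx_entire[of "\<lambda>_. c"] assms(2)] by simp

lemma entire_approx_cong:
  "(\<And>z. z \<in> K \<Longrightarrow> f z = g z) \<Longrightarrow> entire_approx K f \<Longrightarrow> entire_approx K g"
  unfolding entire_approx_def by simp

lemma entire_approx_power:
  "compact K \<Longrightarrow> entire_approx K f \<Longrightarrow> entire_approx K (\<lambda>z. f z ^ n)"
  by (induction n) (auto intro: entire_approx_mult entire_approx_entire)

lemma entire_approx_sum:
  "(\<And>i. i \<in> I \<Longrightarrow> entire_approx K (f i)) \<Longrightarrow> entire_approx K (\<lambda>z. \<Sum>i\<in>I. f i z)"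
  by (induction I rule: infinite_finite_induct) (auto intro: entire_approx_add entire_approx_entire)

section \<open>Geometric series and the pushing of poles\<close>

lemma entire_approx_geometric:
  assumes "compact K" "entire_approx K u" "\<And>z. z \<in> K \<Longrightarrow> cmod (u z) \<le> q" "q < 1"
  shows "entire_approx K (\<lambda>z. 1 / (1 - u z))"
proof (rule entire_approx_limit)
  fix e :: real assume "e > 0"
  show "\<exists>g. entire_approx K g \<and> (\<forall>z\<in>K. cmod (1 / (1 - u z) - g z) < e)"
  proof (cases "K = {}")
    case False
    then have "q \<ge> 0" using assms(3) by (meson all_not_in_conv norm_ge_zero order_trans)
    then have "(\<lambda>n. q ^ n) \<longlonglongrightarrow> 0" using \<open>q < 1\<close> by (simp add: LIMSEQ_realpow_zero)
    then have "\<forall>\<^sub>F n in sequentially. q ^ n < e * (1 - q)"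
      using \<open>e > 0\<close> \<open>q < 1\<close> by (intro order_tendstoD(2)[where y=0]) auto
    then obtain n where n: "q ^ n < e * (1 - q)"
      by (meson eventually_sequentially order_refl)
    have "cmod (1 / (1 - u z) - (\<Sum>i<n. u z ^ i)) < e" if "z \<in> K" for z
    proof -
      have le: "cmod (u z) \<le> q" using assms(3) that by simp
      then have ne: "u z \<noteq> 1" using \<open>q < 1\<close> by auto
      have "1 - q \<le> cmod (1 - u z)"
        using norm_triangle_ineq2[of 1 "u z"] le by simp
      moreover have "1 / (1 - u z) - (\<Sum>i<n. u z ^ i) = u z ^ n / (1 - u z)"
        using ne by (simp add: sum_gp_strict divide_simps)
      then have "cmod (1 / (1 - u z) - (\<Sum>i<n. u z ^ i)) = cmod (u z) ^ n / cmod (1 - u z)"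
        by (simp add: norm_divide norm_power)
      ultimately have "cmod (1 / (1 - u z) - (\<Sum>i<n. u z ^ i)) \<le> q ^ n / (1 - q)"
        using le \<open>q < 1\<close> \<open>q \<ge> 0\<close> by (auto intro!: frac_le power_mono)
      also have "\<dots> < e" using n \<open>q < 1\<close> by (simp add: field_simps)
      finally show ?thesis .
    qed
    moreover have "entire_approx K (\<lambda>z. \<Sum>i<n. u z ^ i)"
      using assms by (intro entire_approx_sum entire_approx_power)
    ultimately show ?thesis by blast
  qed (use entire_approx_entire[of "\<lambda>_. 0" K] in auto)
qed

text \<open>With u = (b - a) / (z - a) one has 1 / (z - b) = (1 / (z - a)) * (1 / (1 - u)), and the
  last factor is a geometric series converging uniformly on \<open>K\<close> because
  \<open>q < 1\<close>.\<close>

lemma entire_approx_pole_shift: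
  assumes "compact K" "entire_approx K (\<lambda>z. 1 / (z - a))" "a \<notin> K"
    and "\<And>z. z \<in> K \<Longrightarrow> cmod (b - a) \<le> q * cmod (z - a)" "q < 1"
  shows "entire_approx K (\<lambda>z. 1 / (z - b))"
proof -
  have "entire_approx K (\<lambda>z. (b - a) * (1 / (z - a)))"
    using assms by (intro entire_approx_cmult)
  moreover have "cmod ((b - a) * (1 / (z - a))) \<le> q" if "z \<in> K" for z
    using assms(3) assms(4)[OF that] that by (auto simp: norm_mult norm_divide divide_simps)
  ultimately have "entire_approx K (\<lambda>z. 1 / (1 - (b - a) * (1 / (z - a))))"
    using entire_approx_geometric assms by blast
  then have "entire_approx K (\<lambda>z. 1 / (z - a) * (1 / (1 - (b - a) * (1 / (z - a)))))"
    using assms by (intro entire_approx_mult)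
  moreover have "1 / (z - a) * (1 / (1 - (b - a) * (1 / (z - a)))) = 1 / (z - b)" if "z \<in> K" for z
  proof -
    have "z \<noteq> a" using that assms(3) by auto
    then have "1 - (b - a) * (1 / (z - a)) = (z - b) / (z - a)"
      by (simp add: field_simps)
    then show ?thesis using \<open>z \<noteq> a\<close> by (cases "z = b") auto
  qed
  ultimately show ?thesis by (rule entire_approx_cong[rotated])
qed

text \<open>Runge's pole pushing: the approximable poles form an open and relatively closed subset
  of the complement of \<open>K\<close> that contains a point far away, so connectedness gives all
  of them.\<close>

lemma entire_approx_pole:
  assumes K: "compact K" and conn: "connected (- K)" and a: "a \<notin> K"
  shows "entire_approx K (\<lambda>z. 1 / (z - a))"
proof -
  define G where "G = {a. a \<notin> K \<and> entire_approx K (\<lambda>z. 1 / (z - a))}"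
  \<comment> \<open>The hypotheses give a ratio of at most 1/3, below the 1/2 used in the shift.
    Applied from a point of \<open>G\<close> to its neighbours this shows that \<open>G\<close> is
    open; applied from a neighbour back to the centre it shows that the rest of the complement is
    open.\<close>
  have near: "b \<in> G" if "a \<in> G" "\<And>z. z \<in> K \<Longrightarrow> 3 * d \<le> dist a z" "dist a b \<le> d" "d > 0" for a b d
  proof -
    have "cmod (b - a) \<le> (1/2) * cmod (z - a)" if "z \<in> K" for z
      using \<open>\<And>z. z \<in> K \<Longrightarrow> 3 * d \<le> dist a z\<close>[OF that] \<open>dist a b \<le> d\<close> \<open>d > 0\<close>
      by (simp add: dist_norm norm_minus_commute)
    moreover have "b \<notin> K" using that by force
    ultimately show ?thesis using that K unfolding G_def
      by (auto intro: entire_approx_pole_shift[of K a b "1/2"])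
  qed
  have opK: "open (- K)" using K by (simp add: compact_imp_closed open_Compl)
  have opG: "open G"
    unfolding open_dist
  proof
    fix x assume x: "x \<in> G"
    then have "x \<in> - K" by (auto simp: G_def)
    then obtain d where d: "d > 0" "ball x d \<subseteq> - K" using opK by (meson openE)
    have "3 * (d/3) \<le> dist x z" if "z \<in> K" for z
      using d that by (metis ComplD in_mono mem_ball nonzero_mult_div_cancel_left not_le times_divide_eq_right zero_neq_numeral)
    then show "\<exists>e>0. \<forall>y. dist y x < e \<longrightarrow> y \<in> G"
      using near[OF x, of "d/3"] d(1) by (intro exI[of _ "d/3"]) (auto simp: dist_commute)
  qed
  have opH: "open (- K - G)"
    unfolding open_dist
  proof
    fix x assume x: "x \<in> - K - G"
    then obtain d where d: "d > 0" "ball x d \<subseteq> - K" using opK by (meson DiffD1 openE)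
    have "y \<in> - K - G" if y: "dist y x < d/4" for y
    proof -
      have "d \<le> dist x z" if "z \<in> K" for z
        using d that by (metis ComplD in_mono mem_ball not_le)
      then have "3 * (d/4) \<le> dist y z" if "z \<in> K" for z
        using y dist_triangle[of x z y] that by (force simp: dist_commute)
      then have "y \<in> G \<Longrightarrow> x \<in> G" using near[of y "d/4" x] y d(1) by auto
      moreover have "y \<in> ball x d" using y d(1) by (simp add: dist_commute)
      ultimately show ?thesis using d x by auto
    qed
    then show "\<exists>e>0. \<forall>y. dist y x < e \<longrightarrow> y \<in> - K - G"
      using d(1) by (intro exI[of _ "d/4"]) auto
  qed
  obtain B where B: "B > 0" "\<And>z. z \<in> K \<Longrightarrow> cmod z \<le> B"
    using compact_imp_bounded[OF K] unfolding bounded_pos by auto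
  \<comment> \<open>At twice the bounding radius, 1 / (z - w) is a power series in z / w converging
    uniformly on \<open>K\<close>, so the argument has a first pole to start from.\<close>
  define w where "w = complex_of_real (2 * B)"
  have nw: "cmod w = 2 * B" using B(1) by (simp add: w_def)
  have "w \<in> G"
  proof -
    have "cmod (z / w) \<le> 1/2" if "z \<in> K" for z
      using B(2)[OF that] B(1) nw by (simp add: norm_divide divide_simps)
    moreover have "entire_approx K (\<lambda>z. z / w)"
      using nw B(1) by (intro entire_approx_entire holomorphic_intros) auto
    ultimately have "entire_approx K (\<lambda>z. 1 / (1 - z / w))"
      using entire_approx_geometric[OF K, of "\<lambda>z. z / w" "1/2"] by auto
    then have "entire_approx K (\<lambda>z. (- 1 / w) * (1 / (1 - z / w)))"
      using K by (intro entire_approx_cmult)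
    moreover have wK: "w \<notin> K" using B nw by fastforce
    moreover have "(- 1 / w) * (1 / (1 - z / w)) = 1 / (z - w)" if "z \<in> K" for z
    proof -
      have "z \<noteq> w" "w \<noteq> 0" using wK that nw B(1) by auto
      then have "1 - z / w = (w - z) / w" by (simp add: field_simps)
      then show ?thesis using \<open>z \<noteq> w\<close> \<open>w \<noteq> 0\<close> by (simp add: divide_simps)
    qed
    ultimately show ?thesis unfolding G_def by (auto elim: entire_approx_cong[rotated])
  qed
  then have "- K - G = {}"
    using connectedD[OF conn opG opH] by (auto simp: G_def)
  then show ?thesis using a by (auto simp: G_def)
qed

text \<open>One root is split off at a time; no root lies in \<open>K\<close>, so each linear factor
  contributes an approximable pole, and products stay approximable.\<close>

lemma entire_approx_inverse_poly:
  assumes K: "compact K" "connected (- K)" and "\<And>z. z \<in> K \<Longrightarrow> poly P z \<noteq> 0"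
  shows "entire_approx K (\<lambda>z. 1 / poly P z)"
  using assms(3)
proof (induction "degree P" arbitrary: P)
  case 0
  then obtain c where "P = [:c:]" by (metis degree_eq_zeroE)
  then show ?case by (auto intro: entire_approx_entire)
next
  case (Suc n)
  then have "\<not> constant (poly P)" by (metis constant_degree nat.distinct(1))
  then obtain \<zeta> where \<zeta>: "poly P \<zeta> = 0" using fundamental_theorem_of_algebra by blast
  then obtain Q where Q: "P = [:- \<zeta>, 1:] * Q" by (auto simp: poly_eq_0_iff_dvd elim: dvdE)
  have "P \<noteq> 0" using Suc.hyps by auto
  then have "Q \<noteq> 0" using Q by auto
  then have "degree P = Suc (degree Q)" using degree_mult_eq[of "[:- \<zeta>, 1:]" Q] unfolding Q by simp
  then have "n = degree Q" using Suc.hyps by simp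
  moreover have "poly Q z \<noteq> 0" if "z \<in> K" for z using Suc.prems[OF that] Q by auto
  ultimately have "entire_approx K (\<lambda>z. 1 / poly Q z)" using Suc.hyps(1) by blast
  moreover have "\<zeta> \<notin> K" using Suc.prems \<zeta> by auto
  ultimately have "entire_approx K (\<lambda>z. (1 / (z - \<zeta>)) * (1 / poly Q z))"
    using K by (intro entire_approx_mult entire_approx_pole) auto
  then show ?case
    by (rule entire_approx_cong[rotated]) (simp add: Q algebra_simps)
qed

text \<open>The function \<open>1 / (1 + ((z - a) / s) ^ N)\<close> is close to 1 inside the circle and close to 0
  outside; its poles lie on the circle.\<close>

lemma entire_separating_circle:
  assumes K: "compact K" "connected (- K)" and s: "s > 0" "K \<inter> sphere a s = {}" and "\<eta> > 0"
  obtains p where "p holomorphic_on UNIV"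
    "\<And>z. z \<in> K \<Longrightarrow> dist a z < s \<Longrightarrow> cmod (p z - 1) < \<eta>"
    "\<And>z. z \<in> K \<Longrightarrow> dist a z > s \<Longrightarrow> cmod (p z) < \<eta>"
proof -
  \<comment> \<open>Compactness gives a ring around the circle that is free of \<open>K\<close>;
    \<open>q\<close> turns it into a ratio bounded away from 1 on both sides.\<close>
  obtain q where q: "0 < q" "q < 1"
    "\<And>z. z \<in> K \<Longrightarrow> dist a z < s \<Longrightarrow> cmod ((z - a) / of_real s) \<le> q"
    "\<And>z. z \<in> K \<Longrightarrow> dist a z > s \<Longrightarrow> 1 / q \<le> cmod ((z - a) / of_real s)"
  proof (cases "K = {}")
    case False
    obtain d where d: "d > 0" "\<And>x y. x \<in> K \<Longrightarrow> y \<in> sphere a s \<Longrightarrow> d \<le> dist x y"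
      using separate_compact_closed[of K "sphere a s"] K(1) s(2) by auto
    \<comment> \<open>The cap s/2 keeps \<open>(s - \<mu>) / s\<close> positive.\<close>
    define \<mu> where "\<mu> = min d (s/2)"
    have \<mu>: "\<mu> > 0" "\<mu> < s" "\<mu> \<le> d" using d(1) s(1) by (auto simp: \<mu>_def)
    have gap: "\<mu> \<le> \<bar>dist a z - s\<bar>" if "z \<in> K" for z
    proof (cases "z = a")
      case True
      then show ?thesis using \<mu> by simp
    next
      case False
      \<comment> \<open>The radial projection of \<open>z\<close> to the circle, so that
        \<open>dist z y\<close> equals \<open>\<bar>dist a z - s\<bar>\<close>.\<close>
      define y where "y = a + of_real (s / dist a z) * (z - a)"
      have "dist a y = s" using False s(1) by (simp add: y_def dist_norm norm_mult norm_divide norm_minus_commute)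
      moreover have "z - y = of_real (1 - s / dist a z) * (z - a)" by (simp add: y_def algebra_simps)
      then have "dist z y = \<bar>1 - s / dist a z\<bar> * dist a z"
        by (simp only: dist_norm norm_mult norm_of_real norm_minus_commute)
      then have "dist z y = \<bar>dist a z - s\<bar>" using False
        by (simp add: abs_mult_pos left_diff_distrib)
      ultimately show ?thesis using d(2)[OF that, of y] \<mu>(3) by simp
    qed
    show ?thesis
    proof (rule that[of "max ((s - \<mu>) / s) (s / (s + \<mu>))"])
      show "0 < max ((s - \<mu>) / s) (s / (s + \<mu>))" using \<mu> s by (simp add: less_max_iff_disj)
      show "max ((s - \<mu>) / s) (s / (s + \<mu>)) < 1" using \<mu> s by simp
      show "cmod ((z - a) / of_real s) \<le> max ((s - \<mu>) / s) (s / (s + \<mu>))"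
        if "z \<in> K" "dist a z < s" for z
      proof -
        have "cmod (z - a) \<le> s - \<mu>" using gap[OF that(1)] that(2)
          by (simp add: dist_norm norm_minus_commute)
        then have "cmod ((z - a) / of_real s) \<le> (s - \<mu>) / s"
          using s(1) by (simp add: norm_divide divide_right_mono)
        then show ?thesis by simp
      qed
      show "1 / max ((s - \<mu>) / s) (s / (s + \<mu>)) \<le> cmod ((z - a) / of_real s)"
        if "z \<in> K" "dist a z > s" for z
      proof -
        have "s + \<mu> \<le> cmod (z - a)" using gap[OF that(1)] that(2)
          by (simp add: dist_norm norm_minus_commute)
        then have "(s + \<mu>) / s \<le> cmod ((z - a) / of_real s)"
          using s(1) by (simp add: norm_divide divide_right_mono)
        moreover have "1 / max ((s - \<mu>) / s) (s / (s + \<mu>)) \<le> 1 / (s / (s + \<mu>))"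
          using \<mu> s by (intro divide_left_mono) (auto simp: less_max_iff_disj)
        ultimately show ?thesis by simp
      qed
    qed
  qed (use that[of "1/2"] in auto)
  have "(\<lambda>n. q ^ n) \<longlonglongrightarrow> 0" using q by (simp add: LIMSEQ_realpow_zero)
  \<comment> \<open>The bound 1/2 keeps \<open>1 + u\<close> away from 0 inside; \<eta>/4 then
    yields an error below \<eta>/2, leaving the other half for replacing the rational function by an
    entire one.\<close>
  then have "\<forall>\<^sub>F n in sequentially. q ^ n < min (1/2) (\<eta> / 4)"
    using \<open>\<eta> > 0\<close> by (intro order_tendstoD(2)[where y=0]) auto
  then obtain N where N: "q ^ N < min (1/2) (\<eta> / 4)"
    by (meson eventually_sequentially order_refl)
  define P where "P = 1 + [:- a / of_real s, 1 / of_real s:] ^ N"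
  have P: "poly P z = 1 + ((z - a) / of_real s) ^ N" for z
    by (simp add: P_def poly_power diff_divide_distrib)
  have inside: "poly P z \<noteq> 0 \<and> cmod (1 / poly P z - 1) < \<eta> / 2" if "z \<in> K" "dist a z < s" for z
  proof -
    define u where "u = ((z - a) / of_real s) ^ N"
    have u: "cmod u \<le> q ^ N" unfolding u_def norm_power
      using q(3)[OF that] by (intro power_mono) auto
    then have u2: "cmod u < 1/2" "cmod u < \<eta>/4" using N by auto
    have lb: "1/2 < cmod (1 + u)" using norm_diff_ineq[of 1 u] u2 by simp
    then have ne: "1 + u \<noteq> 0" by auto
    then have "1 / (1 + u) - 1 = - u / (1 + u)" by (simp add: field_simps)
    then have "cmod (1 / (1 + u) - 1) = cmod u / cmod (1 + u)" by (simp add: norm_divide)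
    also have "\<dots> < \<eta> / 2" using lb u2 \<open>\<eta> > 0\<close>
      frac_less[of "cmod u" "\<eta>/4" "1/2" "cmod (1 + u)"] by simp
    finally show ?thesis using ne by (simp add: P u_def)
  qed
  have outside: "poly P z \<noteq> 0 \<and> cmod (1 / poly P z) < \<eta> / 2" if "z \<in> K" "dist a z > s" for z
  proof -
    define u where "u = ((z - a) / of_real s) ^ N"
    have "(1/q) ^ N \<le> cmod u" unfolding u_def norm_power
      using q that by (intro power_mono) auto
    moreover have "1 / q ^ N > max 2 (4 / \<eta>)"
      using N q(1) \<open>\<eta> > 0\<close> by (auto simp: field_simps)
    ultimately have u: "cmod u > 2" "cmod u > 4 / \<eta>" by (auto simp: power_one_over)
    have "cmod u - 1 \<le> cmod (1 + u)" using norm_diff_ineq[of u 1] by (simp add: add.commute)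
    then have lb: "cmod u / 2 < cmod (1 + u)" using u by simp
    then have ne: "1 + u \<noteq> 0" using u by auto
    have "2 / \<eta> < cmod (1 + u)" using lb u(2) by simp
    then have "1 / cmod (1 + u) < \<eta> / 2" using \<open>\<eta> > 0\<close> ne
      by (simp add: field_simps)
    then show ?thesis using ne by (simp add: P u_def norm_divide)
  qed
  have "poly P z \<noteq> 0" if "z \<in> K" for z
  proof -
    have "dist a z \<noteq> s" using that s(2) by auto
    then show ?thesis using inside outside that by (meson linorder_neqE_linordered_idom)
  qed
  then have "entire_approx K (\<lambda>z. 1 / poly P z)" using entire_approx_inverse_poly K by blast
  then obtain p where p: "p holomorphic_on UNIV" "\<forall>z\<in>K. cmod (1 / poly P z - p z) < \<eta> / 2"
    unfolding entire_approx_def using \<open>\<eta> > 0\<close> half_gt_zero by blast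
  show thesis
  proof (rule that[OF p(1)])
    show "cmod (p z - 1) < \<eta>" if "z \<in> K" "dist a z < s" for z
      using norm_triangle_lt[of "p z - 1 / poly P z" "1 / poly P z - 1" \<eta>] inside[OF that] p(2) that(1)
      by (force simp: norm_minus_commute)
    show "cmod (p z) < \<eta>" if "z \<in> K" "dist a z > s" for z
      using norm_triangle_lt[of "p z - 1 / poly P z" "1 / poly P z" \<eta>] outside[OF that] p(2) that(1)
      by (force simp: norm_minus_commute)
  qed
qed

section \<open>Approximation of constants on a locally finite family of discs\<close>

text \<open>Janiszewski's theorem: two compact plane sets with connected complements that meet in a
  connected set have a union with connected complement. The new disc can meet only the large disc
  \<open>cball 0 R\<close>, which may cut through it, and does so in a convex set.\<close>

lemma connected_Compl_cballs:
  fixes a :: "'i \<Rightarrow> complex"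
  assumes "finite I" "disjoint_family_on (\<lambda>i. cball (a i) (r i)) I"
  shows "connected (- (cball 0 R \<union> (\<Union>i\<in>I. cball (a i) (r i))))"
  using assms
proof (induction I)
  case empty
  then show ?case by (simp add: connected_complement_bounded_convex)
next
  case (insert i I)
  let ?S = "cball 0 R \<union> (\<Union>i\<in>I. cball (a i) (r i))"
  have "?S \<inter> cball (a i) (r i) = cball 0 R \<inter> cball (a i) (r i)"
    using insert by (force simp: disjoint_family_on_def)
  then have "connected (?S \<inter> cball (a i) (r i))"
    by (simp add: convex_Int convex_connected)
  moreover have "compact ?S" using insert(1) by (intro compact_Un compact_UN) auto
  moreover have "connected (- ?S)" using insert by (simp add: disjoint_family_on_insert)
  moreover have "connected (- cball (a i) (r i))"
    by (simp add: connected_complement_bounded_convex)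
  ultimately have "connected (- (?S \<union> cball (a i) (r i)))"
    using closed_cball Janiszewski_connected by blast
  moreover have "?S \<union> cball (a i) (r i) = cball 0 R \<union> (\<Union>i\<in>insert i I. cball (a i) (r i))" by blast
  ultimately show ?case by metis
qed

text \<open>\<open>g + p * (c - g)\<close> is near \<open>g\<close> where \<open>p\<close> is near 0
  and near \<open>c\<close> where \<open>p\<close> is near 1. The separating circle runs in the gap
  between the disc and \<open>K\<close>, and \<open>c - g\<close> is bounded on both. The radius may
  be 0, the disc then being a point.\<close>

lemma entire_adjust_on_cball:
  assumes K: "compact K" "K \<inter> cball a r = {}" "connected (- (K \<union> cball a r))"
    and r: "r \<ge> 0" and g: "g holomorphic_on UNIV" and "\<epsilon> > 0"
  obtains g' where "g' holomorphic_on UNIV" "\<And>z. z \<in> K \<Longrightarrow> cmod (g' z - g z) < \<epsilon>"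
    "\<And>z. z \<in> cball a r \<Longrightarrow> cmod (g' z - c) < \<epsilon>"
proof -
  obtain d where d: "d > 0" "\<And>x y. x \<in> K \<Longrightarrow> y \<in> cball a r \<Longrightarrow> d \<le> dist x y"
    using separate_compact_closed[of K "cball a r"] K by auto
  define s where "s = r + d / 2"
  have s: "s > 0" "s > r" using d(1) r by (auto simp: s_def)
  have out: "dist a z > s" if "z \<in> K" for z
  proof (rule ccontr)
    assume le: "\<not> dist a z > s"
    have "z \<notin> cball a r" using that K(2) by blast
    then have za: "dist a z > r" "z \<noteq> a" using r by auto
    \<comment> \<open>Radial projection to the boundary circle of the disc; for \<open>r = 0\<close>
      it is the centre.\<close>
    define y where "y = a + of_real (r / dist a z) * (z - a)"
    have "dist a y = r" using za r by (simp add: y_def dist_norm norm_mult norm_divide norm_minus_commute)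
    moreover have "z - y = of_real (1 - r / dist a z) * (z - a)" by (simp add: y_def algebra_simps)
    then have "dist z y = \<bar>1 - r / dist a z\<bar> * dist a z"
      by (simp only: dist_norm norm_mult norm_of_real norm_minus_commute)
    then have "dist z y = \<bar>dist a z - r\<bar>" using za
      by (simp add: abs_mult_pos left_diff_distrib)
    ultimately have "d \<le> \<bar>dist a z - r\<bar>" using d(2)[OF that, of y] by simp
    then show False using le za d(1) by (simp add: s_def)
  qed
  let ?K = "K \<union> cball a r"
  have cK: "compact ?K" using K by auto
  have "continuous_on ?K (\<lambda>z. c - g z)"
    using g by (intro continuous_intros) (meson continuous_on_subset holomorphic_on_imp_continuous_on top_greatest)
  then have "bounded ((\<lambda>z. c - g z) ` ?K)" by (intro compact_imp_bounded compact_continuous_image cK)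
  then obtain M where M: "M > 0" "\<And>z. z \<in> ?K \<Longrightarrow> cmod (c - g z) \<le> M"
    unfolding bounded_pos by auto
  have "?K \<inter> sphere a s = {}" using out s by fastforce
  moreover have "\<epsilon> / M > 0" using M \<open>\<epsilon> > 0\<close> by simp
  ultimately obtain p where p: "p holomorphic_on UNIV"
    "\<And>z. z \<in> ?K \<Longrightarrow> dist a z < s \<Longrightarrow> cmod (p z - 1) < \<epsilon> / M"
    "\<And>z. z \<in> ?K \<Longrightarrow> dist a z > s \<Longrightarrow> cmod (p z) < \<epsilon> / M"
    using entire_separating_circle[OF cK K(3) s(1), of a "\<epsilon> / M"] by metis
  have small: "cmod (x * (c - g z)) < \<epsilon>" if "cmod x < \<epsilon> / M" "z \<in> ?K" for x z
  proof -
    have "cmod (x * (c - g z)) \<le> cmod x * M" using M(2)[OF that(2)] by (simp add: norm_mult mult_left_mono)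
    also have "\<dots> < (\<epsilon> / M) * M" using that(1) M(1) by (intro mult_strict_right_mono)
    finally show ?thesis using M(1) by simp
  qed
  show thesis
  proof (rule that[of "\<lambda>z. g z + p z * (c - g z)"])
    show "(\<lambda>z. g z + p z * (c - g z)) holomorphic_on UNIV"
      using g p(1) by (intro holomorphic_intros)
    show "cmod (g z + p z * (c - g z) - g z) < \<epsilon>" if "z \<in> K" for z
      using small[of "p z" z] p(3)[of z] out that by simp
    show "cmod (g z + p z * (c - g z) - c) < \<epsilon>" if "z \<in> cball a r" for z
    proof -
      have "g z + p z * (c - g z) - c = (p z - 1) * (c - g z)" by (simp add: algebra_simps)
      then show ?thesis using small[of "p z - 1" z] p(2)[of z] that s by simp
    qed
  qed
qed

text \<open>The increments from stage \<open>m\<close> on sum to at most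
  \<open>D * (1/2) ^ (m + 1)\<close>. The starting stage \<open>N\<close> is a parameter because
  different points come under control at different stages.\<close>

lemma geometric_increments_limit:
  fixes x :: "nat \<Rightarrow> complex"
  assumes "\<And>m. m \<ge> N \<Longrightarrow> cmod (x (Suc m) - x m) \<le> D * (1/2) ^ (m + 2)" "D \<ge> 0"
  shows "convergent x" "m \<ge> N \<Longrightarrow> cmod (lim x - x m) \<le> D * (1/2) ^ (m + 1)"
proof -
  have *: "cmod (x (m + k) - x m) \<le> D * ((1/2) ^ (m + 1) - (1/2) ^ (m + k + 1))" if "m \<ge> N" for m k
  proof (induction k)
    case (Suc k)
    have "cmod (x (m + Suc k) - x m) \<le> cmod (x (Suc (m + k)) - x (m + k)) + cmod (x (m + k) - x m)"
      using norm_triangle_ineq[of "x (Suc (m + k)) - x (m + k)" "x (m + k) - x m"] by simp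
    then show ?case using Suc assms(1)[of "m + k"] that by (simp add: algebra_simps)
  qed simp
  have **: "cmod (x (m + k) - x m) \<le> D * (1/2) ^ (m + 1)" if "m \<ge> N" for m k
  proof (rule order_trans[OF *[OF that]])
    show "D * ((1/2) ^ (m + 1) - (1/2) ^ (m + k + 1)) \<le> D * (1/2) ^ (m + 1)"
      by (rule mult_left_mono[OF _ assms(2)]) simp
  qed
  show conv: "convergent x"
    unfolding Cauchy_convergent_iff[symmetric]
  proof (rule metric_CauchyI)
    fix e :: real assume "e > 0"
    have "(\<lambda>m. D * (1/2) ^ (m + 1)) \<longlonglongrightarrow> D * 0"
      by (intro tendsto_intros LIMSEQ_ignore_initial_segment LIMSEQ_realpow_zero) auto
    then have "\<forall>\<^sub>F m in sequentially. D * (1/2) ^ (m + 1) < e / 2"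
      using \<open>e > 0\<close> by (intro order_tendstoD(2)[where y="D*0"]) auto
    then obtain M where M: "M \<ge> N" "D * (1/2) ^ (M + 1) < e / 2"
      unfolding eventually_sequentially by (metis max.cobounded1 max.cobounded2)
    have near: "dist (x m) (x M) < e / 2" if "m \<ge> M" for m
      using **[OF M(1), of "m - M"] M(2) that by (simp add: dist_norm)
    have "dist (x m) (x n) < e" if "m \<ge> M" "n \<ge> M" for m n
      using near[OF that(1)] near[OF that(2)] dist_triangle_half_l by blast
    then show "\<exists>M. \<forall>m\<ge>M. \<forall>n\<ge>M. dist (x m) (x n) < e" by blast
  qed
  show "cmod (lim x - x m) \<le> D * (1/2) ^ (m + 1)" if "m \<ge> N" for m
  proof (rule Lim_norm_ubound)
    show "((\<lambda>k. x k - x m) \<longlongrightarrow> lim x - x m) sequentially"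
      using conv by (intro tendsto_intros) (simp add: convergent_LIMSEQ_iff)
    show "\<forall>\<^sub>F k in sequentially. cmod (x k - x m) \<le> D * (1/2) ^ (m + 1)"
      unfolding eventually_sequentially using **[OF that] by (metis le_iff_add)
  qed auto
qed

text \<open>Stage \<open>n\<close> corrects the current function on disc \<open>n\<close> and
  changes it little on all earlier discs and on a disc about 0. The radii of the latter tend to
  infinity, which gives locally uniform convergence; the former preserve the values already
  achieved.\<close>

proposition entire_approx_constants_seq:
  fixes a c :: "nat \<Rightarrow> complex" and r e :: "nat \<Rightarrow> real"
  assumes r: "\<And>k. r k \<ge> 0"
    and disj: "disjoint_family (\<lambda>k. cball (a k) (r k))"
    and lim: "filterlim (\<lambda>k. cmod (a k) - r k) at_top sequentially"
    and e: "\<And>k. e k > 0"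
  obtains g where "g holomorphic_on UNIV"
    "\<And>k z. z \<in> cball (a k) (r k) \<Longrightarrow> cmod (g z - c k) < e k"
proof -
  \<comment> \<open>The minimum over \<open>e 0, ..., e n\<close> makes each change affordable on
    every disc treated so far; the entry 1 bounds the changes uniformly, and the powers of 1/2 make
    them summable.\<close>
  define \<epsilon> where "\<epsilon> n = Min (insert 1 (e ` {..n})) * (1/2) ^ (n + 2)" for n
  have \<epsilon>_pos: "\<epsilon> n > 0" for n using e by (simp add: \<epsilon>_def)
  have \<epsilon>_le1: "\<epsilon> n \<le> 1 * (1/2) ^ (n + 2)" for n
    unfolding \<epsilon>_def by (intro mult_right_mono) auto
  have \<epsilon>_le: "\<epsilon> n \<le> e k * (1/2) ^ (n + 2)" if "k \<le> n" for k n
    unfolding \<epsilon>_def using that by (intro mult_right_mono Min_le) auto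
  define C where "C k = cball (a k) (r k)" for k
  \<comment> \<open>The radius stops 1 short of disc \<open>n\<close>, so the two are disjoint;
    while it is negative the ball is empty.\<close>
  define K where "K n = cball 0 (cmod (a n) - r n - 1) \<union> (\<Union>k<n. C k)" for n
  have Kc: "compact (K n)" for n unfolding K_def C_def by (intro compact_Un compact_UN) auto
  have Kd: "K n \<inter> cball (a n) (r n) = {}" for n
  proof -
    have "cball 0 (cmod (a n) - r n - 1) \<inter> cball (a n) (r n) = {}"
    proof (rule ccontr)
      assume "cball 0 (cmod (a n) - r n - 1) \<inter> cball (a n) (r n) \<noteq> {}"
      then obtain z where "cmod z \<le> cmod (a n) - r n - 1" "dist (a n) z \<le> r n" by auto
      then show False using norm_triangle_ineq2[of "a n" z] by (simp add: dist_norm)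
    qed
    moreover have "C k \<inter> cball (a n) (r n) = {}" if "k < n" for k
      using disjoint_family_onD[OF disj, of k n] that by (simp add: C_def)
    ultimately show ?thesis unfolding K_def by blast
  qed
  have Kconn: "connected (- (K n \<union> cball (a n) (r n)))" for n
  proof -
    have "K n \<union> cball (a n) (r n) = cball 0 (cmod (a n) - r n - 1) \<union> (\<Union>k\<in>{..n}. cball (a k) (r k))"
      unfolding K_def C_def lessThan_Suc_atMost[symmetric] lessThan_Suc by auto
    then show ?thesis using connected_Compl_cballs[of "{..n}" a r] disjoint_family_on_mono[OF _ disj] by simp
  qed
  define Q where "Q n g g' \<longleftrightarrow> (\<forall>z\<in>K n. cmod (g' z - g z) < \<epsilon> n) \<and>
      (\<forall>z\<in>C n. cmod (g' z - c n) < \<epsilon> n)" for n and g g' :: "complex \<Rightarrow> complex"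
  have "\<exists>G. \<forall>n. (G n) holomorphic_on UNIV \<and> Q n (G n) (G (Suc n))"
  proof (rule dependent_nat_choice)
    show "\<exists>g. g holomorphic_on (UNIV :: complex set)" by (intro exI[of _ "\<lambda>_. 0"]) simp
    show "\<exists>g'. g' holomorphic_on UNIV \<and> Q n g g'" if g: "g holomorphic_on UNIV" for g n
    proof -
      obtain g' where "g' holomorphic_on UNIV" "\<And>z. z \<in> K n \<Longrightarrow> cmod (g' z - g z) < \<epsilon> n"
        "\<And>z. z \<in> cball (a n) (r n) \<Longrightarrow> cmod (g' z - c n) < \<epsilon> n"
        using entire_adjust_on_cball[OF Kc Kd Kconn r g \<epsilon>_pos] by metis
      then show ?thesis unfolding Q_def C_def by blast
    qed
  qed
  then obtain G where G: "\<And>n. (G n) holomorphic_on UNIV" "\<And>n. Q n (G n) (G (Suc n))" by blast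
  define g where "g z = lim (\<lambda>n. G n z)" for z
  have close: "cmod (g z - c k) < e k" if "z \<in> cball (a k) (r k)" for k z
  proof -
    \<comment> \<open>Disc \<open>k\<close> receives its value in the step from \<open>G k\<close>
      to \<open>G (Suc k)\<close> and is protected only afterwards, hence the count starts at
      \<open>Suc k\<close>.\<close>
    have "cmod (G (Suc m) z - G m z) \<le> e k * (1/2) ^ (m + 2)" if m: "m \<ge> Suc k" for m
    proof -
      have "z \<in> K m" using m \<open>z \<in> cball (a k) (r k)\<close> by (auto simp: K_def C_def)
      then have "cmod (G (Suc m) z - G m z) < \<epsilon> m" using G(2)[of m] by (simp add: Q_def)
      then show ?thesis using \<epsilon>_le[of k m] m by simp
    qed
    then have "cmod (g z - G (Suc k) z) \<le> e k * (1/2) ^ (Suc k + 1)"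
      unfolding g_def using e[of k]
      by (intro geometric_increments_limit(2)[where N="Suc k"]) auto
    then have "cmod (g z - G (Suc k) z) \<le> e k * (1/2) ^ (k + 2)" by simp
    moreover have "cmod (G (Suc k) z - c k) < e k * (1/2) ^ (k + 2)"
      using G(2)[of k] that \<epsilon>_le[of k k] by (force simp: Q_def C_def)
    moreover have "e k * (1/2) ^ (k + 2) \<le> e k / 4"
      using e[of k] power_le_one[of "1/2::real" k] by (simp add: mult_left_le)
    moreover have "cmod (g z - c k) \<le> cmod (g z - G (Suc k) z) + cmod (G (Suc k) z - c k)"
      using norm_triangle_ineq[of "g z - G (Suc k) z" "G (Suc k) z - c k"] by simp
    ultimately show ?thesis using e[of k] by linarith
  qed
  have "g holomorphic_on UNIV"
  proof (rule holomorphic_uniform_sequence[OF _ G(1)])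
    fix x :: complex
    \<comment> \<open>Of the margin 2, one unit pays for the unit ball around \<open>x\<close> and
      one for the gap that \<open>K n\<close> leaves before disc \<open>n\<close>.\<close>
    have "\<forall>\<^sub>F n in sequentially. cmod x + 2 \<le> cmod (a n) - r n"
      using lim by (simp add: filterlim_at_top)
    then obtain N where N: "\<And>n. n \<ge> N \<Longrightarrow> cmod x + 2 \<le> cmod (a n) - r n"
      unfolding eventually_sequentially by auto
    have bd: "cmod (g z - G m z) \<le> 1 * (1/2) ^ (m + 1)" if "z \<in> cball x 1" "m \<ge> N" for z m
      unfolding g_def
    proof (rule geometric_increments_limit(2)[OF _ _ that(2)])
      fix m assume m: "m \<ge> N"
      have "cmod z \<le> cmod x + 1"
        using that(1) norm_triangle_ineq2[of z x] by (simp add: dist_norm norm_minus_commute)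
      then have "z \<in> K m" using N[OF m] by (auto simp: K_def)
      then show "cmod (G (Suc m) z - G m z) \<le> 1 * (1/2) ^ (m + 2)"
        using G(2)[of m] \<epsilon>_le1[of m] by (force simp: Q_def)
    qed simp
    have "uniform_limit (cball x 1) G g sequentially"
    proof (rule uniform_limitI)
      fix d :: real assume "d > 0"
      have "(\<lambda>m. (1/2::real) ^ (m + 1)) \<longlonglongrightarrow> 0"
        by (intro LIMSEQ_ignore_initial_segment LIMSEQ_realpow_zero) auto
      then have "\<forall>\<^sub>F m in sequentially. (1/2::real) ^ (m + 1) < d"
        using \<open>d > 0\<close> by (intro order_tendstoD(2)[where y=0]) auto
      then show "\<forall>\<^sub>F m in sequentially. \<forall>z\<in>cball x 1. dist (G m z) (g z) < d"
        using eventually_ge_at_top[of N]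
      proof eventually_elim
        case (elim m)
        then show ?case using bd[of _ m] by (force simp: dist_norm norm_minus_commute)
      qed
    qed
    then show "\<exists>d>0. cball x d \<subseteq> UNIV \<and> uniform_limit (cball x d) G g sequentially"
      by (intro exI[of _ 1]) auto
  qed auto
  then show thesis using that close by blast
qed

text \<open>A locally finite set of centres can be enumerated, and since the radii are at most 1 the
  discs go to infinity with their centres.\<close>

lemma entire_approx_constants:
  fixes S :: "complex set" and c :: "complex \<Rightarrow> complex" and \<rho> e :: "complex \<Rightarrow> real"
  assumes S: "infinite S" "\<And>R. finite {a \<in> S. cmod a \<le> R}"
    and \<rho>: "\<And>a. 0 \<le> \<rho> a" "\<And>a. \<rho> a \<le> 1"
    and disj: "disjoint_family_on (\<lambda>a. cball a (\<rho> a)) S"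
    and e: "\<forall>a\<in>S. e a > 0"
  obtains g where "g holomorphic_on UNIV"
    "\<And>a z. a \<in> S \<Longrightarrow> z \<in> cball a (\<rho> a) \<Longrightarrow> cmod (g z - c a) < e a"
proof -
  have "S = (\<Union>n::nat. {a \<in> S. cmod a \<le> real n})" using real_arch_simple by auto
  moreover have "countable (\<Union>n::nat. {a \<in> S. cmod a \<le> real n})"
    using S(2) by (intro countable_UN) (auto intro: countable_finite)
  ultimately have "countable S" by simp
  define a where "a = from_nat_into S"
  have a: "bij_betw a UNIV S" unfolding a_def using \<open>countable S\<close> S(1) by (rule bij_betw_from_nat_into)
  then have inj: "inj a" and rng: "range a = S" by (auto simp: bij_betw_def)
  have "filterlim (\<lambda>k. cmod (a k) - \<rho> (a k)) at_top sequentially"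
    unfolding filterlim_at_top
  proof
    fix Z
    have "finite (a -` {x \<in> S. cmod x \<le> Z + 1})" using S(2) inj by (intro finite_vimageI) auto
    then obtain N where "\<And>k. k \<in> a -` {x \<in> S. cmod x \<le> Z + 1} \<Longrightarrow> k < N"
      by (auto simp: finite_nat_set_iff_bounded)
    then have "Z \<le> cmod (a k) - \<rho> (a k)" if "k \<ge> N" for k
    proof -
      have "\<not> cmod (a k) \<le> Z + 1"
        using that \<open>\<And>k. k \<in> a -` {x \<in> S. cmod x \<le> Z + 1} \<Longrightarrow> k < N\<close>[of k] rng by auto
      then show ?thesis using \<rho>(2)[of "a k"] by simp
    qed
    then show "\<forall>\<^sub>F k in sequentially. Z \<le> cmod (a k) - \<rho> (a k)"
      unfolding eventually_sequentially by blast
  qed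
  moreover have "disjoint_family (\<lambda>k. cball (a k) (\<rho> (a k)))"
    unfolding disjoint_family_on_def
  proof (intro ballI impI)
    fix i j :: nat assume "i \<noteq> j"
    then have "a i \<noteq> a j" using inj by (simp add: inj_eq)
    then show "cball (a i) (\<rho> (a i)) \<inter> cball (a j) (\<rho> (a j)) = {}"
      using disjoint_family_onD[OF disj, of "a i" "a j"] rng by auto
  qed
  moreover have "e (a k) > 0" for k using e rng by auto
  ultimately obtain g where g: "g holomorphic_on UNIV"
    "\<And>k z. z \<in> cball (a k) (\<rho> (a k)) \<Longrightarrow> cmod (g z - c (a k)) < e (a k)"
    using entire_approx_constants_seq[of "\<lambda>k. \<rho> (a k)" a "\<lambda>k. e (a k)" "\<lambda>k. c (a k)"] \<rho>(1) by blast
  show thesis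
  proof (rule that[OF g(1)])
    fix b z assume "b \<in> S" "z \<in> cball b (\<rho> b)"
    moreover obtain k where "b = a k" using \<open>b \<in> S\<close> rng by auto
    ultimately show "cmod (g z - c b) < e b" using g(2)[of z k] by simp
  qed
qed

text \<open>Adding a multiple of an entire function that is nearly 1 on the ball around \<open>a0\<close> and
  nearly 0 on all the others makes the value at \<open>z0\<close> exact.\<close>

lemma entire_approx_constants_interpolate:
  fixes S :: "complex set" and c :: "complex \<Rightarrow> complex" and \<rho> e :: "complex \<Rightarrow> real"
  assumes S: "infinite S" "\<And>R. finite {a \<in> S. cmod a \<le> R}"
    and \<rho>: "\<And>a. 0 \<le> \<rho> a" "\<And>a. \<rho> a \<le> 1"
    and disj: "disjoint_family_on (\<lambda>a. cball a (\<rho> a)) S"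
    and e: "\<forall>a\<in>S. e a > 0"
    and z0: "a0 \<in> S" "z0 \<in> cball a0 (\<rho> a0)"
  obtains g where "g holomorphic_on UNIV"
    "\<And>a z. a \<in> S \<Longrightarrow> z \<in> cball a (\<rho> a) \<Longrightarrow> cmod (g z - c a) < e a" "g z0 = c a0"
proof -
  \<comment> \<open>Budget in units of \<open>e' a\<close>: 1 for \<open>g\<close> and at most 2 for
    the correction. On the ball of \<open>a0\<close>, \<open>\<kappa>\<close> is at most (4/3)
    \<open>e' a0\<close> and \<open>H\<close> at most 5/4 in modulus; elsewhere
    \<open>\<kappa>\<close> is at most 1 and \<open>H\<close> at most \<open>e' a\<close>.\<close>
  define e' where "e' a = min 1 (e a) / 4" for a
  have e': "e' a > 0" "4 * e' a \<le> e a" "4 * e' a \<le> 1" if "a \<in> S" for a using e that by (auto simp: e'_def)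
  obtain g where g: "g holomorphic_on UNIV"
    "\<And>a z. a \<in> S \<Longrightarrow> z \<in> cball a (\<rho> a) \<Longrightarrow> cmod (g z - c a) < e' a"
    using entire_approx_constants[OF S \<rho> disj, of e' c] e'(1) by blast
  obtain H where H: "H holomorphic_on UNIV"
    "\<And>a z. a \<in> S \<Longrightarrow> z \<in> cball a (\<rho> a) \<Longrightarrow> cmod (H z - (if a = a0 then 1 else 0)) < e' a"
    using entire_approx_constants[OF S \<rho> disj, of e' "\<lambda>a. if a = a0 then 1 else 0"] e'(1) by blast
  define \<kappa> where "\<kappa> = (c a0 - g z0) / H z0"
  have "cmod (H z0 - 1) < 1/4" using H(2)[OF z0] e'(3)[OF z0(1)] by simp
  then have H0: "cmod (H z0) \<ge> 3/4" using norm_triangle_ineq2[of 1 "1 - H z0"]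
    by (simp add: norm_minus_commute)
  have num: "cmod (c a0 - g z0) < e' a0" using g(2)[OF z0] by (simp add: norm_minus_commute)
  have \<kappa>: "cmod \<kappa> \<le> e' a0 / (3/4)"
    unfolding \<kappa>_def norm_divide using num H0 e'(1)[OF z0(1)] by (intro frac_le) auto
  show thesis
  proof (rule that[of "\<lambda>z. g z + \<kappa> * H z"])
    show "(\<lambda>z. g z + \<kappa> * H z) holomorphic_on UNIV" using g(1) H(1) by (intro holomorphic_intros)
    show "g z0 + \<kappa> * H z0 = c a0" using H0 by (auto simp: \<kappa>_def)
    show "cmod (g z + \<kappa> * H z - c a) < e a" if az: "a \<in> S" "z \<in> cball a (\<rho> a)" for a z
    proof -
      have tri: "cmod (g z + \<kappa> * H z - c a) \<le> cmod (g z - c a) + cmod \<kappa> * cmod (H z)"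
        using norm_triangle_ineq[of "g z - c a" "\<kappa> * H z"] by (simp add: norm_mult algebra_simps)
      have "cmod \<kappa> * cmod (H z) \<le> 2 * e' a"
      proof (cases "a = a0")
        case True
        then have "cmod (H z - 1) < 1/4" using H(2)[OF az] e'(3)[OF z0(1)] by simp
        then have "cmod (H z) \<le> 5/4" using norm_triangle_ineq[of "H z - 1" 1] by simp
        then have "cmod \<kappa> * cmod (H z) \<le> (e' a0 / (3/4)) * (5/4)"
          using \<kappa> e'(1)[OF z0(1)] by (intro mult_mono) auto
        then show ?thesis using True e'(1)[OF z0(1)] by simp
      next
        case False
        then have "cmod (H z) \<le> e' a" using H(2)[OF az] by simp
        moreover have "cmod \<kappa> \<le> 1" using \<kappa> e'(3)[OF z0(1)] by simp
        ultimately have "cmod \<kappa> * cmod (H z) \<le> 1 * e' a" by (intro mult_mono) auto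
        then show ?thesis using e'(1)[OF az(1)] by simp
      qed
      then show ?thesis using tri g(2)[OF az] e'[OF az(1)] by linarith
    qed
  qed
qed

section \<open>The torus of pairs of complex numbers modulo Gaussian integers\<close>

definition gauss_ints :: "complex set" where
  "gauss_ints = {z. Re z \<in> \<int> \<and> Im z \<in> \<int>}"

lemma gauss_ints_0 [simp]: "0 \<in> gauss_ints"
  and gauss_ints_of_nat [simp]: "of_nat n \<in> gauss_ints"
  and gauss_ints_add: "x \<in> gauss_ints \<Longrightarrow> y \<in> gauss_ints \<Longrightarrow> x + y \<in> gauss_ints"
  and gauss_ints_diff: "x \<in> gauss_ints \<Longrightarrow> y \<in> gauss_ints \<Longrightarrow> x - y \<in> gauss_ints"
  and gauss_ints_minus [simp]: "- x \<in> gauss_ints \<longleftrightarrow> x \<in> gauss_ints"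
  by (auto simp: gauss_ints_def)

lemma gauss_ints_norm_ge_1:
  assumes "x \<in> gauss_ints" "x \<noteq> 0"
  shows "cmod x \<ge> 1"
proof -
  have "\<bar>Re x\<bar> \<ge> 1 \<or> \<bar>Im x\<bar> \<ge> 1"
    using assms Ints_nonzero_abs_ge1 by (auto simp: gauss_ints_def complex_eq_iff)
  then show ?thesis using abs_Re_le_cmod[of x] abs_Im_le_cmod[of x] by linarith
qed

lemma closed_gauss_ints: "closed gauss_ints"
proof -
  have "gauss_ints = Re -` \<int> \<inter> Im -` \<int>" by (auto simp: gauss_ints_def)
  moreover have "closed (Re -` \<int>)" "closed (Im -` \<int>)"
    by (intro closed_vimage closed_Ints continuous_intros)+
  ultimately show ?thesis by (metis closed_Int)
qed

text \<open>The flat distance from 0 of the class of \<open>z\<close> in E. Discs in E are sublevel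
  sets of its translates, so conditions on torus points can be written on C.\<close>

definition gdist :: "complex \<Rightarrow> real" where
  "gdist z = infdist z gauss_ints"

lemma continuous_on_gdist [continuous_intros]:
  "continuous_on S f \<Longrightarrow> continuous_on S (\<lambda>x. gdist (f x))"
  unfolding gdist_def by (intro continuous_intros)

lemma gdist_le: "l \<in> gauss_ints \<Longrightarrow> gdist z \<le> cmod (z - l)"
  unfolding gdist_def by (metis dist_norm infdist_le)

lemma gdist_attained: obtains l where "l \<in> gauss_ints" "gdist z = cmod (z - l)"
  using infdist_attains_inf[OF closed_gauss_ints, of z] gauss_ints_0
  unfolding gdist_def dist_norm by (metis empty_iff)

lemma gdist_le_norm: "gdist z \<le> cmod z"
  using gdist_le[of 0 z] by simp

lemma gdist_nonneg [simp]: "gdist z \<ge> 0"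
  by (simp add: gdist_def infdist_nonneg)

lemma gdist_add_le: "gdist (x + y) \<le> gdist x + gdist y"
proof -
  obtain l k where lk: "l \<in> gauss_ints" "gdist x = cmod (x - l)" "k \<in> gauss_ints" "gdist y = cmod (y - k)"
    by (metis gdist_attained)
  have "gdist (x + y) \<le> cmod (x + y - (l + k))"
    using lk by (intro gdist_le gauss_ints_add)
  also have "x + y - (l + k) = (x - l) + (y - k)" by simp
  finally show ?thesis using norm_triangle_ineq[of "x - l" "y - k"] lk by linarith
qed

lemma gdist_minus [simp]: "gdist (- x) = gdist x"
proof -
  have "gdist (- x) \<le> gdist x" for x
  proof -
    obtain l where l: "l \<in> gauss_ints" "gdist x = cmod (x - l)" by (metis gdist_attained)
    have "gdist (- x) \<le> cmod (- x - (- l))" using l by (intro gdist_le) simp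
    then show ?thesis using l by (simp add: norm_minus_commute)
  qed
  from this[of x] this[of "- x"] show ?thesis by simp
qed

lemma gdist_diff_le: "gdist (x - y) \<le> gdist x + gdist y"
  using gdist_add_le[of x "- y"] by simp

lemma gdist_gauss_ints: "l \<in> gauss_ints \<Longrightarrow> gdist l = 0"
  using gdist_le[of l l] gdist_nonneg[of l] by simp

lemma gdist_cong:
  assumes "x - y \<in> gauss_ints"
  shows "gdist x = gdist y"
  using gdist_add_le[of "x - y" y] gdist_diff_le[of x "x - y"] gdist_gauss_ints[OF assms] by simp

text \<open>Nonzero Gaussian integers have modulus at least 1, so within radius 1/2 none is nearer
  than 0.\<close>

lemma gdist_eq_norm:
  assumes "cmod z \<le> 1/2"
  shows "gdist z = cmod z"
proof -
  obtain l where l: "l \<in> gauss_ints" "gdist z = cmod (z - l)" by (metis gdist_attained)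
  show ?thesis
  proof (cases "l = 0")
    case False
    then have "cmod l \<ge> 1" using l gauss_ints_norm_ge_1 by blast
    then have "cmod (z - l) \<ge> 1/2" using norm_triangle_ineq2[of l z] assms by (simp add: norm_minus_commute)
    then show ?thesis using l gdist_le_norm[of z] assms by simp
  qed (use l in simp)
qed

section \<open>The lattice, its quotient and the quotient topology in coordinates\<close>

definition lat2 :: "cvec set" where
  "lat2 = {x \<in> Cn 2. x 0 \<in> gauss_ints \<and> x 1 \<in> gauss_ints}"

definition vec2 :: "complex \<Rightarrow> complex \<Rightarrow> cvec" where
  "vec2 z w = (\<lambda>i. if i = 0 then z else if i = 1 then w else 0)"

definition proj2 :: "complex \<Rightarrow> complex \<Rightarrow> cvec set" where
  "proj2 z w = torus_proj lat2 (vec2 z w)"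

lemma vec2_simps [simp]: "vec2 z w 0 = z" "vec2 z w 1 = w" "vec2 z w (Suc 0) = w"
  by (auto simp: vec2_def)

lemma vec2_in_Cn [simp]: "vec2 z w \<in> Cn 2"
  by (auto simp: vec2_def Cn_def)

lemma Cn_2_eq_vec2: "x \<in> Cn 2 \<Longrightarrow> x = vec2 (x 0) (x 1)"
  by (force simp: vec2_def Cn_def not_less_eq numeral_2_eq_2 fun_eq_iff Suc_le_eq)

lemma torus_proj_eq_iff:
  assumes "x \<in> Cn 2" "y \<in> Cn 2"
  shows "torus_proj lat2 x = torus_proj lat2 y \<longleftrightarrow> x 0 - y 0 \<in> gauss_ints \<and> x 1 - y 1 \<in> gauss_ints"
proof
  assume eq: "torus_proj lat2 x = torus_proj lat2 y"
  have "(\<lambda>_. 0) \<in> lat2" by (auto simp: lat2_def Cn_def)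
  then have "x \<in> torus_proj lat2 x" by (force simp: torus_proj_def)
  then obtain l where "l \<in> lat2" "x = (\<lambda>i. y i + l i)" using eq by (auto simp: torus_proj_def)
  then show "x 0 - y 0 \<in> gauss_ints \<and> x 1 - y 1 \<in> gauss_ints" by (auto simp: lat2_def)
next
  have sub: "torus_proj lat2 x \<subseteq> torus_proj lat2 y"
    if "x \<in> Cn 2" "y \<in> Cn 2" "x 0 - y 0 \<in> gauss_ints" "x 1 - y 1 \<in> gauss_ints" for x y
  proof
    fix u assume "u \<in> torus_proj lat2 x"
    then obtain l where l: "l \<in> lat2" "u = (\<lambda>i. x i + l i)" by (auto simp: torus_proj_def)
    have "(\<lambda>i. (x i - y i) + l i) \<in> lat2"
      using that l by (auto simp: lat2_def Cn_def intro!: gauss_ints_add)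
    moreover have "u = (\<lambda>i. y i + ((x i - y i) + l i))" using l by auto
    ultimately show "u \<in> torus_proj lat2 y" unfolding torus_proj_def by (intro image_eqI)
  qed
  assume "x 0 - y 0 \<in> gauss_ints \<and> x 1 - y 1 \<in> gauss_ints"
  then show "torus_proj lat2 x = torus_proj lat2 y"
    using sub[of x y] sub[of y x] assms by (metis gauss_ints_minus minus_diff_eq subset_antisym)
qed

lemma proj2_eq_iff:
  "proj2 z w = proj2 z' w' \<longleftrightarrow> z - z' \<in> gauss_ints \<and> w - w' \<in> gauss_ints"
  unfolding proj2_def by (subst torus_proj_eq_iff) auto

lemma torus_eq_proj2: "torus 2 lat2 = {proj2 z w | z w. True}"
proof -
  have "torus_proj lat2 x \<in> {proj2 z w | z w. True}" if "x \<in> Cn 2" for x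
    using arg_cong[OF Cn_2_eq_vec2[OF that], of "torus_proj lat2"] unfolding proj2_def by auto
  then show ?thesis by (auto simp: torus_def proj2_def)
qed

lemma proj2_in_torus [simp]: "proj2 z w \<in> torus 2 lat2"
  by (auto simp: torus_eq_proj2)

lemma torus_proj_eq_proj2: "x \<in> Cn 2 \<Longrightarrow> torus_proj lat2 x = proj2 (x 0) (x 1)"
  unfolding proj2_def by (rule arg_cong[OF Cn_2_eq_vec2])

lemma continuous_vec2: "continuous_on UNIV (\<lambda>p. vec2 (fst p) (snd p))"
proof (rule continuous_on_coordinatewise_then_product)
  fix i show "continuous_on UNIV (\<lambda>p. vec2 (fst p) (snd p) i)"
    unfolding vec2_def by (cases "i = 0"; cases "i = 1") (auto intro!: continuous_intros)
qed

text \<open>\<open>vec2\<close> and the two coordinates identify pairs with \<open>Cn 2\<close>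
  homeomorphically, so openness in the quotient can be tested on pairs.\<close>

lemma openin_torus2_iff:
  "openin (torus_topology 2 lat2) U \<longleftrightarrow>
     U \<subseteq> torus 2 lat2 \<and> open {p. proj2 (fst p) (snd p) \<in> U}"
proof (cases "U \<subseteq> torus 2 lat2")
  case True
  have "openin (top_of_set (Cn 2)) {x \<in> Cn 2. torus_proj lat2 x \<in> U} \<longleftrightarrow>
        open {p. proj2 (fst p) (snd p) \<in> U}" (is "?L \<longleftrightarrow> ?R")
  proof
    assume ?L
    then obtain T where T: "open T" "{x \<in> Cn 2. torus_proj lat2 x \<in> U} = Cn 2 \<inter> T"
      by (auto simp: openin_open)
    have "proj2 (fst p) (snd p) \<in> U \<longleftrightarrow> vec2 (fst p) (snd p) \<in> T" for p
    proof -
      have "vec2 (fst p) (snd p) \<in> {x \<in> Cn 2. torus_proj lat2 x \<in> U} \<longleftrightarrow>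
          vec2 (fst p) (snd p) \<in> Cn 2 \<inter> T" using T(2) by simp
      then show ?thesis by (simp add: proj2_def)
    qed
    then have "{p. proj2 (fst p) (snd p) \<in> U} = (\<lambda>p. vec2 (fst p) (snd p)) -` T" by auto
    then show ?R using open_vimage[OF T(1) continuous_vec2] by simp
  next
    assume R: ?R
    have "continuous_on UNIV (\<lambda>x::cvec. (x 0, x 1))"
      by (intro continuous_intros continuous_on_product_coordinates)
    from open_vimage[OF R this]
    have "open ((\<lambda>x::cvec. (x 0, x 1)) -` {p. proj2 (fst p) (snd p) \<in> U})" .
    moreover have "{x \<in> Cn 2. torus_proj lat2 x \<in> U} =
        Cn 2 \<inter> ((\<lambda>x::cvec. (x 0, x 1)) -` {p. proj2 (fst p) (snd p) \<in> U})"
      by (auto simp: torus_proj_eq_proj2)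
    ultimately show ?L by (auto simp: openin_open)
  qed
  then show ?thesis using True by (simp add: openin_torus_topology)
qed (simp add: openin_torus_topology)

lemma closedin_torus2_iff:
  "closedin (torus_topology 2 lat2) U \<longleftrightarrow>
     U \<subseteq> torus 2 lat2 \<and> closed {p. proj2 (fst p) (snd p) \<in> U}"
proof -
  have "{p. proj2 (fst p) (snd p) \<in> torus 2 lat2 - U} = - {p. proj2 (fst p) (snd p) \<in> U}" by auto
  then show ?thesis
    by (auto simp: closedin_def topspace_torus_topology openin_torus2_iff open_closed)
qed

lemma proj2_in_closure_ofI:
  assumes "(z, w) \<in> closure {p. proj2 (fst p) (snd p) \<in> A}"
  shows "proj2 z w \<in> torus_topology 2 lat2 closure_of A"
  unfolding in_closure_of topspace_torus_topology
proof (intro conjI allI impI)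
  fix T assume T: "proj2 z w \<in> T \<and> openin (torus_topology 2 lat2) T"
  then have "open {p. proj2 (fst p) (snd p) \<in> T}" "(z, w) \<in> {p. proj2 (fst p) (snd p) \<in> T}"
    by (auto simp: openin_torus2_iff)
  then obtain p where "p \<in> {p. proj2 (fst p) (snd p) \<in> A}" "p \<in> {p. proj2 (fst p) (snd p) \<in> T}"
    using assms unfolding closure_iff_nhds_not_empty by blast
  then show "\<exists>y. y \<in> A \<and> y \<in> T" by auto
qed simp

text \<open>A lattice-invariant condition on coordinates descends to the torus, where membership can
  be read off from any representative.\<close>

lemma proj2_set_iff:
  assumes "\<And>z w z' w'. z - z' \<in> gauss_ints \<Longrightarrow> w - w' \<in> gauss_ints \<Longrightarrow> P z w \<Longrightarrow> P z' w'"
  shows "proj2 z w \<in> {proj2 z w | z w. P z w} \<longleftrightarrow> P z w"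
proof
  assume "proj2 z w \<in> {proj2 z w | z w. P z w}"
  then obtain z' w' where "proj2 z' w' = proj2 z w" "P z' w'" by force
  then show "P z w" using assms[of z' z w' w] by (simp add: proj2_eq_iff)
qed blast

lemma complex_lattice_lat2: "complex_lattice 2 lat2"
proof -
  have "discrete lat2"
    unfolding discrete_def isolated_in_def
  proof
    fix x assume x: "x \<in> lat2"
    \<comment> \<open>Distinct lattice points differ by at least 1 in some coordinate, so open unit
      discs in both coordinates isolate \<open>x\<close>.\<close>
    define T :: "cvec set" where "T = (\<lambda>y. y 0) -` ball (x 0) 1 \<inter> (\<lambda>y. y 1) -` ball (x 1) 1"
    have "open T" unfolding T_def
      by (intro open_Int open_vimage open_ball continuous_on_product_coordinates)
    moreover have "y = x" if "y \<in> T" "y \<in> lat2" for y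
    proof -
      have "y i = x i" if "i = 0 \<or> i = 1" for i
      proof (rule ccontr)
        assume "y i \<noteq> x i"
        moreover have "x i - y i \<in> gauss_ints" using that x \<open>y \<in> lat2\<close> by (auto simp: lat2_def intro: gauss_ints_diff)
        ultimately have "cmod (x i - y i) \<ge> 1" by (intro gauss_ints_norm_ge_1) auto
        then show False using that \<open>y \<in> T\<close> by (auto simp: T_def dist_norm)
      qed
      then show ?thesis using x \<open>y \<in> lat2\<close> Cn_2_eq_vec2 unfolding lat2_def by (metis (no_types, lifting) mem_Collect_eq)
    qed
    moreover have "x \<in> T" by (simp add: T_def)
    ultimately show "x \<in> lat2 \<and> (\<exists>T. open T \<and> T \<inter> lat2 = {x})" using x by blast
  qed
  moreover have "\<exists>b. Z_basis (2 * 2) b lat2"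
  proof -
    define b :: "nat \<Rightarrow> cvec" where
      "b j = (if j = 0 then vec2 1 0 else if j = 1 then vec2 \<i> 0 else if j = 2 then vec2 0 1 else vec2 0 \<i>)" for j
    define \<Phi> :: "(nat \<Rightarrow> int) \<Rightarrow> cvec" where "\<Phi> c = (\<lambda>i. \<Sum>j<4. of_int (c j) * b j i)" for c
    have \<Phi>: "\<Phi> c = vec2 (Complex (of_int (c 0)) (of_int (c 1))) (Complex (of_int (c 2)) (of_int (c 3)))" for c
    proof -
      have "{..<4::nat} = {0,1,2,3}" by auto
      then show ?thesis
        unfolding \<Phi>_def by (auto simp: b_def vec2_def fun_eq_iff complex_eq_iff)
    qed
    have "bij_betw \<Phi> ({..<4} \<rightarrow>\<^sub>E UNIV) lat2"
    proof (rule bij_betw_imageI)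
      show "inj_on \<Phi> ({..<4} \<rightarrow>\<^sub>E UNIV)"
      proof (rule inj_onI)
        fix c d :: "nat \<Rightarrow> int" assume c: "c \<in> {..<4} \<rightarrow>\<^sub>E UNIV" and d: "d \<in> {..<4} \<rightarrow>\<^sub>E UNIV" and eq: "\<Phi> c = \<Phi> d"
        have "\<Phi> c 0 = \<Phi> d 0" "\<Phi> c 1 = \<Phi> d 1" using eq by auto
        then have e: "c 0 = d 0" "c 1 = d 1" "c 2 = d 2" "c 3 = d 3" by (auto simp: \<Phi>)
        show "c = d"
        proof (rule PiE_ext[OF c d])
          fix x :: nat assume "x \<in> {..<4}"
          then have "x = 0 \<or> x = 1 \<or> x = 2 \<or> x = 3" by auto
          then show "c x = d x" using e by auto
        qed
      qed
      show "\<Phi> ` ({..<4} \<rightarrow>\<^sub>E UNIV) = lat2"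
      proof (intro equalityI subsetI)
        fix x assume "x \<in> \<Phi> ` ({..<4} \<rightarrow>\<^sub>E UNIV)"
        then obtain c where "x = \<Phi> c" by blast
        then show "x \<in> lat2" unfolding \<Phi> lat2_def gauss_ints_def by simp
      next
        fix x assume x: "x \<in> lat2"
        then obtain p q r s where "Re (x 0) = of_int p" "Im (x 0) = of_int q" "Re (x 1) = of_int r" "Im (x 1) = of_int s"
          by (auto simp: lat2_def gauss_ints_def elim!: Ints_cases)
        moreover have "x = vec2 (x 0) (x 1)" using x Cn_2_eq_vec2 by (auto simp: lat2_def)
        ultimately have "x = vec2 (Complex (of_int p) (of_int q)) (Complex (of_int r) (of_int s))"
          by (metis complex_surj)
        moreover define c where
          "c = restrict (\<lambda>j. if j = 0 then p else if j = 1 then q else if j = 2 then r else s) {..<4::nat}"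
        have "c 0 = p" "c 1 = q" "c 2 = r" "c 3 = s" by (auto simp: c_def)
        ultimately have "x = \<Phi> c" unfolding \<Phi> by (simp only:)
        moreover have "c \<in> {..<4} \<rightarrow>\<^sub>E UNIV" by (simp add: c_def)
        ultimately show "x \<in> \<Phi> ` ({..<4} \<rightarrow>\<^sub>E UNIV)" by (rule image_eqI)
      qed
    qed
    moreover have "\<Phi> = (\<lambda>c i. \<Sum>j<4. of_int (c j) * b j i)" by (intro ext) (simp only: \<Phi>_def)
    ultimately have "Z_basis (2 * 2) b lat2" unfolding Z_basis_def by simp
    then show ?thesis by blast
  qed
  ultimately show ?thesis
    unfolding complex_lattice_def
    by (auto simp: lat2_def Cn_def intro: gauss_ints_diff)
qed

section \<open>Curves with bounded derivative\<close>

lemma holomorphic_liftD: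
  assumes "holomorphic_lift n \<Lambda> f U g"
  shows "open U" "z \<in> U \<Longrightarrow> g z \<in> Cn n" "z \<in> U \<Longrightarrow> f z = torus_proj \<Lambda> (g z)"
    "(\<lambda>z. g z i) holomorphic_on U"
  using assms by (auto simp: holomorphic_lift_def)

text \<open>The difference of two lifts is continuous with values in the lattice, whose points are
  at least 1 apart, so it cannot jump on a connected set. Coordinates from 2 on vanish for both
  lifts.\<close>

lemma holomorphic_lift_diff_constant:
  assumes g: "holomorphic_lift 2 lat2 f U g" and k: "holomorphic_lift 2 lat2 f V k"
    and W: "connected W" "W \<subseteq> U" "W \<subseteq> V"
  shows "(\<lambda>z. g z i - k z i) constant_on W"
proof (cases "i < 2")
  case True
  have int: "g z i - k z i \<in> gauss_ints" if "z \<in> W" for z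
  proof -
    have "z \<in> U" "z \<in> V" using that W by auto
    then have "torus_proj lat2 (g z) = torus_proj lat2 (k z)" "g z \<in> Cn 2" "k z \<in> Cn 2"
      using holomorphic_liftD(2,3)[OF g, of z] holomorphic_liftD(2,3)[OF k, of z] by simp_all
    then show ?thesis using True torus_proj_eq_iff[of "g z" "k z"] by (auto simp: less_2_cases_iff)
  qed
  show ?thesis
  proof (rule continuous_discrete_range_constant[OF W(1)])
    show "continuous_on W (\<lambda>z. g z i - k z i)"
      using W holomorphic_liftD(4)[OF g, of i] holomorphic_liftD(4)[OF k, of i]
      by (intro continuous_intros) (meson continuous_on_subset holomorphic_on_imp_continuous_on)+
    show "\<exists>e>0. \<forall>y. y \<in> W \<and> g y i - k y i \<noteq> g x i - k x i \<longrightarrow>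
        e \<le> cmod (g y i - k y i - (g x i - k x i))" if "x \<in> W" for x
      using gauss_ints_norm_ge_1[OF gauss_ints_diff[OF int int[OF that]]]
      by (intro exI[of _ 1]) auto
  qed
next
  case False
  then have "g z i - k z i = 0" if "z \<in> W" for z
    using holomorphic_liftD(2)[OF g, of z] holomorphic_liftD(2)[OF k, of z] that subsetD[OF W(2)]
      subsetD[OF W(3)] by (simp add: Cn_def)
  then show ?thesis unfolding constant_on_def by blast
qed

text \<open>Lifts differ by a constant near a point, so every lift there computes the derivative
  that some lift is known to have; in particular the derivative is single-valued.\<close>

lemma has_torus_derivative_unique:
  assumes "has_torus_derivative 2 lat2 f v z" and g: "holomorphic_lift 2 lat2 f U g" "z \<in> U"
  shows "((\<lambda>w. g w i) has_field_derivative v i) (at z)"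
proof -
  obtain V k where k: "z \<in> V" "holomorphic_lift 2 lat2 f V k"
    "((\<lambda>w. k w i) has_field_derivative v i) (at z)"
    using assms(1) unfolding has_torus_derivative_def by blast
  have "open (U \<inter> V)" using g k unfolding holomorphic_lift_def by auto
  then obtain e where e: "e > 0" "ball z e \<subseteq> U \<inter> V" using g(2) k(1) by (meson IntI openE)
  have "(\<lambda>w. g w i - k w i) constant_on ball z e"
    using e by (intro holomorphic_lift_diff_constant[OF g(1) k(2)]) auto
  then obtain c where c: "\<And>w. w \<in> ball z e \<Longrightarrow> g w i - k w i = c" unfolding constant_on_def by blast
  have "((\<lambda>w. k w i + c) has_field_derivative v i) (at z)"
    using k(3) by (auto intro!: derivative_eq_intros)
  then show ?thesis
  proof (rule has_field_derivative_transform_within_open[where S="ball z e"])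
    show "k x i + c = g x i" if "x \<in> ball z e" for x
      using c[OF that] by (simp add: algebra_simps)
  qed (use e in auto)
qed

lemma Re_Cn_inner_self: "Re (Cn_inner n u u) = (\<Sum>i<n. (cmod (u i))\<^sup>2)"
  unfolding Cn_inner_def by (simp add: cmod_power2) (simp add: power2_eq_square)

lemma Cn_inner_self_nonneg: "Re (Cn_inner n u u) \<ge> 0"
  unfolding Re_Cn_inner_self by (intro sum_nonneg) auto

text \<open>The lifts are only local, but their derivatives agree and glue to a bounded entire
  vector function, to which Liouville applies in each coordinate. The affine form is then read off
  from the cosets themselves, without a global lift.\<close>

lemma bounded_torus_derivative_imp_affine:
  assumes hol: "torus_holomorphic 2 lat2 f"
    and bd: "bounded_torus_derivative 2 lat2 (\<lambda>_. Cn_inner 2) f"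
  shows "torus_affine_linear 2 lat2 f"
proof -
  obtain C where C: "\<And>z. \<exists>v. has_torus_derivative 2 lat2 f v z \<and> sqrt (Re (Cn_inner 2 v v)) < C"
    using bd unfolding bounded_torus_derivative_def by blast
  define v where "v z = (SOME v. has_torus_derivative 2 lat2 f v z \<and> sqrt (Re (Cn_inner 2 v v)) < C)" for z
  have v: "has_torus_derivative 2 lat2 f (v z) z" "sqrt (Re (Cn_inner 2 (v z) (v z))) < C" for z
    using someI_ex[OF C[of z]] unfolding v_def by blast+
  have lift: "\<exists>U g. z \<in> U \<and> holomorphic_lift 2 lat2 f U g" for z
    using hol unfolding torus_holomorphic_def by blast
  have vCn: "v z i = 0" if "i \<ge> 2" for z i
  proof -
    obtain U g where g: "z \<in> U" "holomorphic_lift 2 lat2 f U g" using lift by blast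
    have "((\<lambda>w. g w i) has_field_derivative 0) (at z)"
    proof (rule has_field_derivative_transform_within_open[of "\<lambda>_. 0" _ _ U])
      show "0 = g w i" if "w \<in> U" for w
        using g that \<open>i \<ge> 2\<close> unfolding holomorphic_lift_def Cn_def by (auto simp: image_subset_iff)
    qed (use g in \<open>auto simp: holomorphic_lift_def\<close>)
    then show ?thesis using has_torus_derivative_unique[OF v(1) g(2,1), of i] DERIV_unique by blast
  qed
  have vhol: "(\<lambda>z. v z i) holomorphic_on UNIV" for i
    unfolding holomorphic_on_def
  proof
    fix z :: complex
    obtain U g where g: "z \<in> U" "holomorphic_lift 2 lat2 f U g" using lift by blast
    then have U: "open U" and gi: "(\<lambda>w. g w i) holomorphic_on U" by (auto simp: holomorphic_lift_def)
    have "deriv (\<lambda>w. g w i) w = v w i" if "w \<in> U" for w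
      using has_torus_derivative_unique[OF v(1) g(2) that] by (rule DERIV_imp_deriv)
    then have "(\<lambda>w. v w i) holomorphic_on U"
      using holomorphic_deriv[OF gi U] by (simp cong: holomorphic_cong)
    then show "(\<lambda>z. v z i) field_differentiable at z within UNIV"
      using U g(1) holomorphic_on_imp_differentiable_at by blast
  qed
  have vbd: "cmod (v z i) \<le> C" for z i
  proof -
    have C0: "0 \<le> C" using v(2)[of z] real_sqrt_ge_zero[OF Cn_inner_self_nonneg[of 2 "v z"]] by linarith
    show ?thesis
    proof (cases "i < 2")
      case True
      then have "(cmod (v z i))\<^sup>2 \<le> Re (Cn_inner 2 (v z) (v z))"
        unfolding Re_Cn_inner_self by (intro member_le_sum) auto
      then have "cmod (v z i) \<le> sqrt (Re (Cn_inner 2 (v z) (v z)))"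
        by (rule real_le_rsqrt)
      then show ?thesis using v(2)[of z] by simp
    qed (use vCn C0 in auto)
  qed
  have "(\<lambda>z. v z i) constant_on UNIV" for i
    using vbd by (intro Liouville_theorem vhol) (auto simp: bounded_iff)
  then have "v z i = v 0 i" for z i unfolding constant_on_def by (metis UNIV_I)
  then obtain b where b: "\<And>z i. v z i = b i" by blast
  \<comment> \<open>The coset \<open>f z\<close> shifted back by \<open>z * b\<close>. In a local
    lift it is the coset of \<open>g z - z * b\<close>, whose derivative is 0, so \<open>F\<close>
    is locally constant on the connected plane.\<close>
  define F where "F z = (\<lambda>x i. x i - z * b i) ` f z" for z
  have "F constant_on UNIV"
  proof (rule locally_constant_imp_constant)
    fix z0 :: complex
    obtain U g where g: "z0 \<in> U" "holomorphic_lift 2 lat2 f U g" using lift by blast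
    then have "open U" by (simp add: holomorphic_lift_def)
    then obtain e where e: "e > 0" "ball z0 e \<subseteq> U" using g(1) by (meson openE)
    have const: "g z i - z * b i = g z0 i - z0 * b i" if "z \<in> ball z0 e" for z i
    proof -
      have "((\<lambda>z. g z i - z * b i) has_field_derivative 0) (at w within ball z0 e)" if "w \<in> ball z0 e" for w
      proof (rule has_field_derivative_at_within)
        have "w \<in> U" using that e(2) by blast
        then have "((\<lambda>z. g z i) has_field_derivative b i) (at w)"
          using has_torus_derivative_unique[OF v(1) g(2), of w i] by (simp add: b)
        then have "((\<lambda>z. g z i - z * b i) has_field_derivative b i - 1 * b i) (at w)"
          by (rule DERIV_diff[OF _ DERIV_cmult_right[OF DERIV_ident]])
        then show "((\<lambda>z. g z i - z * b i) has_field_derivative 0) (at w)" by simp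
      qed
      then have "\<exists>c. \<forall>z\<in>ball z0 e. g z i - z * b i = c"
        by (intro has_field_derivative_zero_constant) auto
      then show ?thesis using that centre_in_ball[of z0 e] e(1) by metis
    qed
    have "F z = F z0" if "z \<in> ball z0 e" for z
    proof -
      have F: "F w = (\<lambda>l i. (g w i - w * b i) + l i) ` lat2" if "w \<in> ball z0 e" for w
      proof -
        have fw: "f w = torus_proj lat2 (g w)" using g(2) e(2) that by (auto simp: holomorphic_lift_def)
        show ?thesis unfolding F_def fw torus_proj_def image_image by (simp add: algebra_simps)
      qed
      show ?thesis using F[OF that] F[of z0] e(1) const[OF that] by simp
    qed
    moreover have "openin (top_of_set UNIV) (ball z0 e)" "z0 \<in> ball z0 e" using e(1) by auto
    ultimately show "\<exists>T. openin (top_of_set UNIV) T \<and> z0 \<in> T \<and> (\<forall>z\<in>T. F z = F z0)" by blast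
  qed auto
  then have F0: "F z = F 0" for z unfolding constant_on_def by (metis UNIV_I)
  obtain U g where g: "0 \<in> U" "holomorphic_lift 2 lat2 f U g" using lift by blast
  define a where "a = g 0"
  have a: "a \<in> Cn 2" "f 0 = torus_proj lat2 a" using g by (auto simp: holomorphic_lift_def a_def)
  have "f z = torus_proj lat2 (\<lambda>i. a i + z * b i)" for z
  proof -
    have "f z = (\<lambda>x i. x i + z * b i) ` F z" unfolding F_def image_image by simp
    also have "F z = f 0" unfolding F0[of z] by (simp add: F_def)
    finally show ?thesis unfolding a(2) torus_proj_def image_image by (simp add: algebra_simps)
  qed
  moreover have "b \<in> Cn 2" using vCn b by (auto simp: Cn_def)
  ultimately show ?thesis unfolding torus_affine_linear_def using a(1) by blast
qed

section \<open>The domains and the affine curves in the closure\<close>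

text \<open>The radii are such that \<open>(1/100) / (1/8) < 1/12\<close>, which is what forces the slope to vanish in
  \<open>slope_eq_0\<close> below.\<close>

definition Omega1_lift :: "complex \<Rightarrow> complex \<Rightarrow> bool" where
  "Omega1_lift z w \<longleftrightarrow> (gdist z \<le> 1/8 \<longrightarrow> gdist w < 1/100) \<and>
     (gdist (z - 1/2) \<le> 1/8 \<longrightarrow> gdist (w - 1/2) < 1/100)"

definition Omega2_lift :: "complex \<Rightarrow> complex \<Rightarrow> bool" where
  "Omega2_lift z w \<longleftrightarrow> gdist z > 1/8 \<and> gdist (z - 1/2) > 1/8"

text \<open>Strict and weak inequalities are exchanged against \<open>Omega1_lift\<close>, so the
  condition is closed; it bounds the closure of \<open>Omega1\<close> from above.\<close>

definition Omega1_lift_closed :: "complex \<Rightarrow> complex \<Rightarrow> bool" where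
  "Omega1_lift_closed z w \<longleftrightarrow> (gdist z < 1/8 \<longrightarrow> gdist w \<le> 1/100) \<and>
     (gdist (z - 1/2) < 1/8 \<longrightarrow> gdist (w - 1/2) \<le> 1/100)"

definition Omega1 :: "cvec set set" where "Omega1 = {proj2 z w | z w. Omega1_lift z w}"

definition Omega2 :: "cvec set set" where "Omega2 = {proj2 z w | z w. Omega2_lift z w}"

lemma gdist_cong_diff: "x - y \<in> gauss_ints \<Longrightarrow> gdist (x - c) = gdist (y - c)"
  by (rule gdist_cong) simp

lemma proj2_in_Omega1_iff: "proj2 z w \<in> Omega1 \<longleftrightarrow> Omega1_lift z w"
  unfolding Omega1_def
proof (rule proj2_set_iff)
  fix z w z' w' :: complex
  assume zw: "z - z' \<in> gauss_ints" "w - w' \<in> gauss_ints" "Omega1_lift z w"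
  show "Omega1_lift z' w'"
    using zw(3) gdist_cong[OF zw(1)] gdist_cong[OF zw(2)] gdist_cong_diff[OF zw(1), of "1/2"]
      gdist_cong_diff[OF zw(2), of "1/2"] unfolding Omega1_lift_def by simp
qed

lemma proj2_in_Omega2_iff: "proj2 z w \<in> Omega2 \<longleftrightarrow> Omega2_lift z w"
  unfolding Omega2_def
proof (rule proj2_set_iff)
  fix z w z' w' :: complex
  assume zw: "z - z' \<in> gauss_ints" "Omega2_lift z w"
  show "Omega2_lift z' w'"
    using zw(2) gdist_cong[OF zw(1)] gdist_cong_diff[OF zw(1), of "1/2"] unfolding Omega2_lift_def by simp
qed

lemma openin_Omega1: "openin (torus_topology 2 lat2) Omega1"
proof -
  have "open {p. \<not> gdist (fst p) \<le> 1/8 \<or> gdist (snd p) < 1/100}"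
    "open {p. \<not> gdist (fst p - 1/2) \<le> 1/8 \<or> gdist (snd p - 1/2) < 1/100}"
    unfolding not_le by (intro open_Collect_disj open_Collect_less continuous_intros)+
  from open_Collect_conj[OF this] have "open {p. Omega1_lift (fst p) (snd p)}"
    unfolding Omega1_lift_def by (simp only: imp_conv_disj)
  then show ?thesis unfolding openin_torus2_iff proj2_in_Omega1_iff by (auto simp: Omega1_def)
qed

lemma openin_Omega2: "openin (torus_topology 2 lat2) Omega2"
proof -
  have "open {p::complex \<times> complex. 1/8 < gdist (fst p) \<and> 1/8 < gdist (fst p - 1/2)}"
    by (intro open_Collect_conj open_Collect_less continuous_intros)
  then have "open {p. Omega2_lift (fst p) (snd p)}" by (simp add: Omega2_lift_def)
  then show ?thesis unfolding openin_torus2_iff proj2_in_Omega2_iff by (auto simp: Omega2_def)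
qed

lemma Omega2_subset_Omega1: "Omega2 \<subseteq> Omega1"
proof -
  have "Omega1_lift z w" if "Omega2_lift z w" for z w using that by (simp add: Omega1_lift_def Omega2_lift_def)
  then show ?thesis unfolding Omega1_def Omega2_def by blast
qed

lemma closure_Omega1_imp_lift:
  assumes "proj2 z w \<in> torus_topology 2 lat2 closure_of Omega1"
  shows "Omega1_lift_closed z w"
proof -
  let ?C = "{proj2 z w | z w. Omega1_lift_closed z w}"
  have iff: "proj2 z w \<in> ?C \<longleftrightarrow> Omega1_lift_closed z w" for z w
  proof (rule proj2_set_iff)
    fix z w z' w' :: complex
    assume zw: "z - z' \<in> gauss_ints" "w - w' \<in> gauss_ints" "Omega1_lift_closed z w"
    show "Omega1_lift_closed z' w'"
      using zw(3) gdist_cong[OF zw(1)] gdist_cong[OF zw(2)] gdist_cong_diff[OF zw(1), of "1/2"]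
        gdist_cong_diff[OF zw(2), of "1/2"] unfolding Omega1_lift_closed_def by simp
  qed
  have "closed {p. \<not> gdist (fst p) < 1/8 \<or> gdist (snd p) \<le> 1/100}"
    "closed {p. \<not> gdist (fst p - 1/2) < 1/8 \<or> gdist (snd p - 1/2) \<le> 1/100}"
    unfolding not_less by (intro closed_Collect_disj closed_Collect_le continuous_intros)+
  from closed_Collect_conj[OF this] have "closed {p. Omega1_lift_closed (fst p) (snd p)}"
    unfolding Omega1_lift_closed_def by (simp only: imp_conv_disj)
  then have "closedin (torus_topology 2 lat2) ?C"
    unfolding closedin_torus2_iff iff by auto
  moreover have "Omega1_lift_closed z w" if "Omega1_lift z w" for z w using that by (auto simp: Omega1_lift_def Omega1_lift_closed_def)
  then have "Omega1 \<subseteq> ?C" unfolding Omega1_def by blast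
  ultimately have "torus_topology 2 lat2 closure_of Omega1 \<subseteq> ?C" by (simp add: closure_of_minimal)
  then show ?thesis using assms iff by blast
qed

lemma gdist_half: "gdist (1/2) = 1/2"
  by (subst gdist_eq_norm) auto

lemma gdist_0 [simp]: "gdist 0 = 0"
  by (simp add: gdist_gauss_ints)

section \<open>The two failures of density\<close>

lemma Omega1_not_dense: "torus_topology 2 lat2 closure_of Omega1 \<noteq> torus 2 lat2"
proof -
  \<comment> \<open>Over the centre of \<open>\<Delta>\<^sub>1\<close> the fibre point 1/2 has
    distance 1/2 from the centre of \<open>D\<^sub>1\<close>.\<close>
  have "\<not> Omega1_lift_closed 0 (1/2)" by (simp add: Omega1_lift_closed_def gdist_half)
  then show ?thesis using closure_Omega1_imp_lift proj2_in_torus by blast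
qed

lemma Omega2_not_dense: "subtopology (torus_topology 2 lat2) Omega1 closure_of Omega2 \<noteq> Omega1"
proof
  assume eq: "subtopology (torus_topology 2 lat2) Omega1 closure_of Omega2 = Omega1"
  \<comment> \<open>A neighbourhood of the point (0, 0) of \<open>Omega1\<close> that lies over the
    interior of \<open>\<Delta>\<^sub>1\<close> and therefore misses \<open>Omega2\<close>.\<close>
  define U where "U = {proj2 z w | z w. gdist z < 1/8}"
  have U: "proj2 z w \<in> U \<longleftrightarrow> gdist z < 1/8" for z w
    unfolding U_def by (rule proj2_set_iff) (use gdist_cong in force)
  have "open {p::complex \<times> complex. gdist (fst p) < 1/8}"
    by (intro open_Collect_less continuous_intros)
  then have op: "openin (torus_topology 2 lat2) U"
    unfolding openin_torus2_iff U by (auto simp: U_def)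
  have "proj2 0 0 \<in> Omega1" unfolding proj2_in_Omega1_iff Omega1_lift_def
    using gdist_half gdist_minus[of "1/2"] by simp
  then have "proj2 0 0 \<in> torus_topology 2 lat2 closure_of Omega2"
    using eq Omega2_subset_Omega1 unfolding closure_of_subtopology by (simp add: inf_absorb2) blast
  moreover have "proj2 0 0 \<in> U" unfolding U by simp
  ultimately obtain y where y: "y \<in> Omega2" "y \<in> U" using op unfolding in_closure_of by blast
  then obtain z w where "y = proj2 z w" "gdist z < 1/8" unfolding U_def by blast
  then show False using y(1) by (simp add: proj2_in_Omega2_iff Omega2_lift_def)
qed

text \<open>A steep line exceeds the tolerance within the disc about 0. A flat one drifts away from
  the lattice along the integers 1, 2, 3, ..., in steps too short to jump over the gap. The
  tolerance is twice 1/100 because two heights are subtracted.\<close>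

lemma slope_eq_0:
  assumes "\<And>s. gdist s < 1/8 \<Longrightarrow> gdist (b * s) \<le> 1/50"
  shows "b = 0"
proof (rule ccontr)
  assume "b \<noteq> 0"
  show False
  \<comment> \<open>The threshold is (3/100) / (1/8). Being below 1/4, it lets the first multiple of
    \<open>cmod b\<close> past 1/4 still end below 1/2.\<close>
  proof (cases "cmod b > 6/25")
    case True
    \<comment> \<open>Chosen so that \<open>b * s\<close> is 3/100, above the tolerance
      1/50.\<close>
    define s where "s = 3/100 / b"
    have "cmod s = 3/100 / cmod b" by (simp add: s_def norm_divide)
    also have "\<dots> < 1/8" using True \<open>b \<noteq> 0\<close> by (simp add: field_simps)
    finally have "gdist s < 1/8" using gdist_le_norm[of s] by simp
    then have "gdist (b * s) \<le> 1/50" by (rule assms)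
    moreover have "b * s = 3/100" using \<open>b \<noteq> 0\<close> by (simp add: s_def)
    moreover have "gdist (3/100) = 3/100" by (subst gdist_eq_norm) auto
    ultimately show False by simp
  next
    case False
    \<comment> \<open>The first multiple of \<open>cmod b\<close> that reaches 1/4; below 1/2,
      \<open>gdist\<close> is the modulus.\<close>
    define k where "k = nat \<lceil>1 / (4 * cmod b)\<rceil>"
    have "real k = of_int \<lceil>1 / (4 * cmod b)\<rceil>" unfolding k_def by (simp add: ceiling_mono)
    then have "1 / (4 * cmod b) \<le> real k" "real k < 1 / (4 * cmod b) + 1" by linarith+
    then have k: "1/4 \<le> real k * cmod b" "real k * cmod b < 1/4 + cmod b"
      using \<open>b \<noteq> 0\<close> by (auto simp: field_simps)
    have nk: "cmod (b * of_nat k) = real k * cmod b" by (simp add: norm_mult)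
    have "gdist (b * of_nat k) = real k * cmod b"
      using k False nk by (subst gdist_eq_norm) auto
    moreover have "gdist (b * of_nat k) \<le> 1/50"
      by (rule assms) (simp add: gdist_gauss_ints)
    ultimately show False using k by simp
  qed
qed

text \<open>The point is pushed radially away from its nearest Gaussian integer. The bound 1/4 stays
  in the range where \<open>gdist\<close> is the modulus, and later keeps the new point off the
  other family of discs.\<close>

lemma gdist_sphere_approx:
  assumes "gdist x = 1/8" "e > 0"
  obtains y where "cmod (y - x) < e" "1/8 < gdist y" "gdist y \<le> 1/4"
proof -
  obtain l where l: "l \<in> gauss_ints" "gdist x = cmod (x - l)" by (metis gdist_attained)
  define \<eta> where "\<eta> = min 1 e"
  have \<eta>: "0 < \<eta>" "\<eta> \<le> 1" "\<eta> \<le> e" using assms by (auto simp: \<eta>_def)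
  define y where "y = x + of_real \<eta> * (x - l)"
  have "gdist y = gdist (y - l)" using l(1) by (intro gdist_cong) simp
  also have "y - l = of_real (1 + \<eta>) * (x - l)" by (simp add: y_def algebra_simps)
  also have n: "cmod (of_real (1 + \<eta>) * (x - l)) = (1 + \<eta>) / 8"
    using \<eta> l assms by (simp only: norm_mult norm_of_real) simp
  then have "gdist (of_real (1 + \<eta>) * (x - l)) = (1 + \<eta>) / 8"
    using \<eta> by (subst gdist_eq_norm) auto
  finally have "gdist y = (1 + \<eta>) / 8" .
  moreover have "cmod (y - x) = \<eta> / 8" using l assms \<eta> by (simp add: y_def norm_mult)
  ultimately show thesis using \<eta> by (intro that[of y]) auto
qed

lemma vertical_in_closure_Omega2:
  assumes "gdist a \<ge> 1/8" "gdist (a - 1/2) \<ge> 1/8"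
  shows "proj2 a w \<in> torus_topology 2 lat2 closure_of Omega2"
proof (rule proj2_in_closure_ofI)
  have "\<exists>z. cmod (z - a) < e \<and> Omega2_lift z w" if epos: "e > 0" for e
  proof -
    \<comment> \<open>The centres 0 and 1/2 are 1/2 apart in E, so a point within 1/4 of one is at
      least 1/4 from the other and outside its disc.\<close>
    have tri: "1/2 \<le> gdist z + gdist (z - 1/2)" for z
      using gdist_diff_le[of z "z - 1/2"] gdist_half by simp
    consider "gdist a > 1/8" "gdist (a - 1/2) > 1/8" | "gdist a = 1/8" | "gdist (a - 1/2) = 1/8"
      using assms by linarith
    then show ?thesis
    proof cases
      case 1
      then show ?thesis using epos by (intro exI[of _ a]) (auto simp: Omega2_lift_def)
    next
      case 2
      then obtain y where y: "cmod (y - a) < e" "1/8 < gdist y" "gdist y \<le> 1/4"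
        using gdist_sphere_approx[OF _ epos] by metis
      then show ?thesis using tri[of y] by (intro exI[of _ y]) (auto simp: Omega2_lift_def)
    next
      case 3
      then obtain y where y: "cmod (y - (a - 1/2)) < e" "1/8 < gdist y" "gdist y \<le> 1/4"
        using gdist_sphere_approx[OF _ epos] by metis
      have "y + 1/2 - a = y - (a - 1/2)" by simp
      then have "cmod (y + 1/2 - a) < e" using y(1) by (simp only:)
      then show ?thesis using y tri[of "y + 1/2"] by (intro exI[of _ "y + 1/2"]) (auto simp: Omega2_lift_def)
    qed
  qed
  then show "(a, w) \<in> closure {p. proj2 (fst p) (snd p) \<in> Omega2}"
    unfolding closure_approachable proj2_in_Omega2_iff
    by (fastforce simp: dist_norm dist_Pair_Pair)
qed

text \<open>Off the fibre the constant function 1 cuts out the empty set. Near it the equation is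
  \<open>z - a\<close>, reduced modulo Gaussian integers to modulus below 1/4, which is a
  well-defined function on a neighbourhood in the torus.\<close>

lemma torus_closed_analytic_vertical: "torus_closed_analytic 2 lat2 {proj2 a w | w. True}"
proof -
  let ?A = "{proj2 a w | w. True}"
  have A: "proj2 z w \<in> ?A \<longleftrightarrow> z - a \<in> gauss_ints" for z w
  proof
    assume "proj2 z w \<in> ?A"
    then show "z - a \<in> gauss_ints" by (auto simp: proj2_eq_iff)
  next
    assume "z - a \<in> gauss_ints"
    then have "proj2 z w = proj2 a w" by (simp add: proj2_eq_iff)
    then show "proj2 z w \<in> ?A" by blast
  qed
  have "closed ((\<lambda>p::complex \<times> complex. fst p - a) -` gauss_ints)"
    by (intro closed_vimage closed_gauss_ints continuous_intros)
  then have clA: "closedin (torus_topology 2 lat2) ?A"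
    unfolding closedin_torus2_iff A by (auto simp: vimage_def)
  have "\<exists>U k (\<phi>::nat \<Rightarrow> cvec set \<Rightarrow> complex). openin (torus_topology 2 lat2) U \<and> p \<in> U \<and>
        (\<forall>j<k. torus_holomorphic_fun_on 2 lat2 (\<phi> j) U) \<and> ?A \<inter> U = {q \<in> U. \<forall>j<k. \<phi> j q = 0}"
    if p: "p \<in> torus 2 lat2" for p
  proof (cases "p \<in> ?A")
    case False
    let ?U = "torus 2 lat2 - ?A"
    have "openin (torus_topology 2 lat2) ?U"
      using clA by (simp add: closedin_def topspace_torus_topology)
    moreover have "torus_holomorphic_fun_on 2 lat2 (\<lambda>_. 1) ?U"
      unfolding torus_holomorphic_fun_on_def Cn_holomorphic_on_def
      by (intro ballI exI[of _ "\<lambda>_. 0"] allI impI exI[of _ 1])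
        (auto simp: Cn_norm_def Cn_inner_self_nonneg)
    moreover have "?A \<inter> ?U = {q \<in> ?U. \<forall>j<(1::nat). (1::complex) = 0}" by auto
    ultimately show ?thesis using False p
      by (intro exI[of _ ?U] exI[of _ 1] exI[of _ "\<lambda>_ _. 1"]) auto
  next
    case True
    define U where "U = {proj2 z w | z w. gdist (z - a) < 1/4}"
    have U: "proj2 z w \<in> U \<longleftrightarrow> gdist (z - a) < 1/4" for z w
      unfolding U_def by (rule proj2_set_iff) (use gdist_cong_diff in metis)
    have "open {p::complex \<times> complex. gdist (fst p - a) < 1/4}"
      by (intro open_Collect_less continuous_intros)
    then have op: "openin (torus_topology 2 lat2) U" unfolding openin_torus2_iff U by (auto simp: U_def)
    \<comment> \<open>Two candidates differ by a Gaussian integer of modulus below 1/2, hence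
      agree.\<close>
    define \<phi> where "\<phi> q = (THE u. cmod u < 1/4 \<and> (\<exists>z w. q = proj2 z w \<and> z - a - u \<in> gauss_ints))" for q
    have \<phi>: "\<phi> (proj2 z w) = u" if u: "cmod u < 1/4" "z - a - u \<in> gauss_ints" for z w u
      unfolding \<phi>_def
    proof (rule the_equality)
      show "cmod u < 1/4 \<and> (\<exists>z' w'. proj2 z w = proj2 z' w' \<and> z' - a - u \<in> gauss_ints)" using u by blast
      fix u' assume u': "cmod u' < 1/4 \<and> (\<exists>z' w'. proj2 z w = proj2 z' w' \<and> z' - a - u' \<in> gauss_ints)"
      then obtain z' where z': "z - z' \<in> gauss_ints" "z' - a - u' \<in> gauss_ints" by (auto simp: proj2_eq_iff)
      have "(z - z') + (z' - a - u') - (z - a - u) \<in> gauss_ints"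
        by (intro gauss_ints_diff[OF gauss_ints_add[OF z'] u(2)])
      moreover have "(z - z') + (z' - a - u') - (z - a - u) = u - u'" by simp
      ultimately have "u - u' \<in> gauss_ints" by simp
      moreover have "cmod (u - u') < 1" using norm_triangle_ineq4[of u u'] u u' by linarith
      ultimately show "u' = u" using gauss_ints_norm_ge_1[of "u - u'"] by fastforce
    qed
    have dec: "\<exists>u. cmod u < 1/4 \<and> z - a - u \<in> gauss_ints" if "gdist (z - a) < 1/4" for z
    proof -
      obtain l where "l \<in> gauss_ints" "gdist (z - a) = cmod (z - a - l)" by (metis gdist_attained)
      then show ?thesis using that by (intro exI[of _ "z - a - l"]) simp
    qed
    have "torus_holomorphic_fun_on 2 lat2 \<phi> U"
      unfolding torus_holomorphic_fun_on_def Cn_holomorphic_on_def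
    proof
      fix x assume x: "x \<in> {x \<in> Cn 2. torus_proj lat2 x \<in> U}"
      then have xU: "x \<in> Cn 2" "gdist (x 0 - a) < 1/4"
        using U[of "x 0" "x 1"] by (auto simp: torus_proj_eq_proj2)
      then obtain u where u: "cmod u < 1/4" "x 0 - a - u \<in> gauss_ints" using dec by blast
      have \<phi>x: "\<phi> (torus_proj lat2 x) = u" unfolding torus_proj_eq_proj2[OF xU(1)] by (rule \<phi>[OF u])
      \<comment> \<open>The radius keeps \<open>u + (y 0 - x 0)\<close> below modulus 1/4, so
        \<open>\<phi>\<close> is exactly affine there and the error is 0.\<close>
      have "cmod (\<phi> (torus_proj lat2 y) - \<phi> (torus_proj lat2 x) - (\<Sum>i<2. vec2 1 0 i * (y i - x i)))
          \<le> e * Cn_norm 2 (\<lambda>i. y i - x i)"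
        if "e > 0" and y: "y \<in> {x \<in> Cn 2. torus_proj lat2 x \<in> U}"
          and d: "Cn_norm 2 (\<lambda>i. y i - x i) < 1/4 - cmod u" for e y
      proof -
        have "cmod (y 0 - x 0) \<le> Cn_norm 2 (\<lambda>i. y i - x i)"
          unfolding Cn_norm_def Re_Cn_inner_self
          by (intro real_le_rsqrt member_le_sum[of 0 "{..<2}" "\<lambda>i. (cmod (y i - x i))\<^sup>2"]) auto
        then have "cmod (u + (y 0 - x 0)) < 1/4"
          using d norm_triangle_ineq[of u "y 0 - x 0"] by linarith
        moreover have "y 0 - a - (u + (y 0 - x 0)) \<in> gauss_ints" using u(2) by (simp add: algebra_simps)
        ultimately have "\<phi> (torus_proj lat2 y) = u + (y 0 - x 0)"
          using y \<phi>[of "u + (y 0 - x 0)" "y 0" "y 1"] by (simp add: torus_proj_eq_proj2)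
        moreover have "(\<Sum>i<2. vec2 1 0 i * (y i - x i)) = y 0 - x 0"
          by (simp add: numeral_2_eq_2)
        ultimately show ?thesis using that(1) \<phi>x by (simp add: Cn_norm_def Cn_inner_self_nonneg)
      qed
      then show "\<exists>L. \<forall>e>0. \<exists>d>0. \<forall>y\<in>{x \<in> Cn 2. torus_proj lat2 x \<in> U}.
          Cn_norm 2 (\<lambda>i. y i - x i) < d \<longrightarrow>
          cmod (\<phi> (torus_proj lat2 y) - \<phi> (torus_proj lat2 x) - (\<Sum>i<2. L i * (y i - x i)))
          \<le> e * Cn_norm 2 (\<lambda>i. y i - x i)"
        using u(1) by (intro exI[of _ "vec2 1 0"] allI impI exI[of _ "1/4 - cmod u"]) auto
    qed
    moreover have "q \<in> ?A \<longleftrightarrow> \<phi> q = 0" if "q \<in> U" for q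
    proof -
      obtain z w where q: "q = proj2 z w" "gdist (z - a) < 1/4" using \<open>q \<in> U\<close> unfolding U_def by blast
      then obtain u where u: "cmod u < 1/4" "z - a - u \<in> gauss_ints" using dec by blast
      have "\<phi> q = u" unfolding q(1) by (rule \<phi>[OF u])
      moreover have "z - a \<in> gauss_ints \<longleftrightarrow> u = 0"
      proof
        assume "z - a \<in> gauss_ints"
        then have "(z - a) - (z - a - u) \<in> gauss_ints" using u(2) by (rule gauss_ints_diff)
        then show "u = 0" using gauss_ints_norm_ge_1[of u] u(1) by fastforce
      qed (use u in simp)
      ultimately show ?thesis unfolding q(1) A by simp
    qed
    then have "?A \<inter> U = {q \<in> U. \<forall>j<(1::nat). \<phi> q = 0}" by blast
    moreover have "p \<in> U"
    proof -
      obtain w where "p = proj2 a w" using True by blast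
      then show ?thesis by (simp add: U)
    qed
    ultimately show ?thesis using op
      by (intro exI[of _ U] exI[of _ 1] exI[of _ "\<lambda>_. \<phi>"]) auto
  qed
  then show ?thesis unfolding torus_closed_analytic_def using clA by blast
qed

lemma affine_in_closure_Omega1:
  assumes aff: "torus_affine_linear 2 lat2 f" and nc: "\<not> f constant_on UNIV"
    and rng: "range f \<subseteq> torus_topology 2 lat2 closure_of Omega1"
  obtains a where "range f = {proj2 a w | w. True}" "gdist a \<ge> 1/8" "gdist (a - 1/2) \<ge> 1/8"
proof -
  obtain a b where ab: "a \<in> Cn 2" "b \<in> Cn 2" "\<And>t. f t = torus_proj lat2 (\<lambda>i. a i + t * b i)"
    using aff unfolding torus_affine_linear_def by blast
  have f: "f t = proj2 (a 0 + t * b 0) (a 1 + t * b 1)" for t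
  proof -
    have "(\<lambda>i. a i + t * b i) \<in> Cn 2" using ab by (auto simp: Cn_def)
    then show ?thesis by (simp add: ab(3) torus_proj_eq_proj2)
  qed
  have c: "Omega1_lift_closed (a 0 + t * b 0) (a 1 + t * b 1)" for t
    using closure_Omega1_imp_lift rng f by (metis range_subsetD)
  have b0: "b 0 = 0"
  proof (rule ccontr)
    assume "b 0 \<noteq> 0"
    \<comment> \<open>Since \<open>b 0\<close> is nonzero, the line is the graph of
      \<open>c0 + \<beta> * z\<close> over the whole base.\<close>
    define \<beta> where "\<beta> = b 1 / b 0"
    define c0 where "c0 = a 1 - \<beta> * a 0"
    have cz: "Omega1_lift_closed z (c0 + \<beta> * z)" for z
      using c[of "(z - a 0) / b 0"] \<open>b 0 \<noteq> 0\<close> by (simp add: \<beta>_def c0_def field_simps)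
    have c0: "gdist c0 \<le> 1/100" using cz[of 0] by (simp add: Omega1_lift_closed_def)
    have "\<beta> = 0"
    proof (rule slope_eq_0)
      fix s assume "gdist s < 1/8"
      then have "gdist (c0 + \<beta> * s) \<le> 1/100" using cz[of s] by (simp add: Omega1_lift_closed_def)
      then show "gdist (\<beta> * s) \<le> 1/50"
        using gdist_diff_le[of "c0 + \<beta> * s" c0] c0 by simp
    qed
    then have "gdist (c0 - 1/2) \<le> 1/100" using cz[of "1/2"] by (simp add: Omega1_lift_closed_def)
    then show False using gdist_diff_le[of c0 "c0 - 1/2"] c0 gdist_half by simp
  qed
  have b1: "b 1 \<noteq> 0"
  proof
    assume "b 1 = 0"
    then have "f t = f 0" for t by (simp add: f b0)
    then show False using nc unfolding constant_on_def by blast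
  qed
  have hit: "\<exists>t. a 1 + t * b 1 = w" for w
    using b1 by (intro exI[of _ "(w - a 1) / b 1"]) simp
  have cw: "Omega1_lift_closed (a 0) w" for w
    using hit[of w] c b0 by (metis add_0_right mult_zero_right)
  show thesis
  proof (rule that[of "a 0"])
    show "range f = {proj2 (a 0) w | w. True}"
    proof (intro equalityI subsetI)
      fix q assume "q \<in> {proj2 (a 0) w | w. True}"
      then obtain w where "q = proj2 (a 0) w" by blast
      moreover obtain t where "a 1 + t * b 1 = w" using hit by blast
      ultimately have "q = f t" by (simp add: f b0)
      then show "q \<in> range f" by blast
    qed (auto simp: f b0)
    \<comment> \<open>The fibre over \<open>a 0\<close> contains 1/2, which violates the first
      constraint, and 0, which violates the second; so neither is active at
      \<open>a 0\<close>.\<close>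
    show "gdist (a 0) \<ge> 1/8" using cw[of "1/2"] gdist_half by (auto simp: Omega1_lift_closed_def)
    show "gdist (a 0 - 1/2) \<ge> 1/8" using cw[of 0] gdist_half gdist_minus[of "1/2"] by (auto simp: Omega1_lift_closed_def)
  qed
qed

section \<open>Dense entire curves\<close>

text \<open>A fundamental domain for the Gaussian integers, shifted so that the closed discs of
  radius 1/8 about 0 and 1/2 lie in its interior.\<close>

definition cell :: "complex set" where
  "cell = {z. - 1/4 \<le> Re z \<and> Re z < 3/4 \<and> - 1/2 \<le> Im z \<and> Im z < 1/2}"

lemma cell_representative: obtains l where "l \<in> gauss_ints" "z - l \<in> cell"
proof (rule that[of "Complex (of_int \<lfloor>Re z + 1/4\<rfloor>) (of_int \<lfloor>Im z + 1/2\<rfloor>)"])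
  show "Complex (of_int \<lfloor>Re z + 1/4\<rfloor>) (of_int \<lfloor>Im z + 1/2\<rfloor>) \<in> gauss_ints"
    by (simp add: gauss_ints_def)
  have "of_int \<lfloor>Re z + 1/4\<rfloor> \<le> Re z + 1/4" "Re z + 1/4 < of_int \<lfloor>Re z + 1/4\<rfloor> + 1"
    "of_int \<lfloor>Im z + 1/2\<rfloor> \<le> Im z + 1/2" "Im z + 1/2 < of_int \<lfloor>Im z + 1/2\<rfloor> + 1"
    by linarith+
  then show "z - Complex (of_int \<lfloor>Re z + 1/4\<rfloor>) (of_int \<lfloor>Im z + 1/2\<rfloor>) \<in> cell"
    by (simp add: cell_def) linarith
qed

text \<open>The ranges admit both a point of \<open>cell\<close> and its shift by -1/2. A Gaussian
  integer within 1/8 then has real and imaginary part strictly between -1 and 1.\<close>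

lemma gauss_int_near_0:
  assumes l: "l \<in> gauss_ints" "cmod (x - l) \<le> 1/8"
    and x: "- 3/4 \<le> Re x" "Re x < 3/4" "- 1/2 \<le> Im x" "Im x < 1/2"
  shows "l = 0"
proof -
  obtain m n where mn: "Re l = of_int m" "Im l = of_int n"
    using l(1) by (auto simp: gauss_ints_def elim!: Ints_cases)
  have "\<bar>Re x - of_int m\<bar> \<le> 1/8" "\<bar>Im x - of_int n\<bar> \<le> 1/8"
    using l(2) abs_Re_le_cmod[of "x - l"] abs_Im_le_cmod[of "x - l"] mn by simp_all
  then have "- 1 < real_of_int m" "real_of_int m < 1" "- 1 < real_of_int n" "real_of_int n < 1"
    using x by (simp_all only: abs_le_iff) linarith+
  then have "m = 0" "n = 0" by linarith+
  then show ?thesis using mn by (simp add: complex_eq_iff)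
qed

section \<open>Discs, centres and tolerances for the prescribed data\<close>

lemma finite_gauss_ints_bounded: "finite {a \<in> gauss_ints. cmod a \<le> R}"
proof (rule finite_subset)
  let ?I = "{- \<lceil>R\<rceil>..\<lceil>R\<rceil>}"
  show "{a \<in> gauss_ints. cmod a \<le> R} \<subseteq> (\<lambda>(m, n). Complex (of_int m) (of_int n)) ` (?I \<times> ?I)"
  proof
    fix a assume a: "a \<in> {a \<in> gauss_ints. cmod a \<le> R}"
    then obtain m n where mn: "Re a = of_int m" "Im a = of_int n"
      by (auto simp: gauss_ints_def elim!: Ints_cases)
    have "\<bar>real_of_int m\<bar> \<le> R" "\<bar>real_of_int n\<bar> \<le> R"
      using a abs_Re_le_cmod[of a] abs_Im_le_cmod[of a] mn by auto
    then have "m \<in> ?I" "n \<in> ?I" by (simp_all add: abs_le_iff) linarith+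
    moreover have "a = Complex (of_int m) (of_int n)" using mn by (simp add: complex_eq_iff)
    ultimately show "a \<in> (\<lambda>(m, n). Complex (of_int m) (of_int n)) ` (?I \<times> ?I)" by force
  qed
qed auto

text \<open>Each data point gets its own member of a locally finite disjoint family: the disc of
  radius 1/8 containing it or, outside all of these, itself as a disc of radius 0. Discs without
  data still carry a target, so that the whole curve stays in \<open>Omega1\<close>. The error
  \<open>2 * \<tau>\<close> leaves one half to the approximation and the other to the derivative
  correction.\<close>

lemma disc_family_through_data:
  fixes \<zeta> \<omega> :: "nat \<Rightarrow> complex"
  assumes cell: "\<And>k. \<zeta> k \<in> cell" and adm: "\<And>k. Omega1_lift (\<zeta> k) (\<omega> k)"
  obtains S \<rho> \<tau> cen c where "infinite S" "\<And>R. finite {a \<in> S. cmod a \<le> R}"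
    "\<And>a. 0 \<le> \<rho> a" "\<And>a. \<rho> a \<le> 1" "disjoint_family_on (\<lambda>a. cball a (\<rho> a)) S"
    "\<forall>a\<in>S. \<tau> a > 0"
    "\<And>k::nat. cen k \<in> S" "\<And>k. \<zeta> k + of_nat k \<in> cball (cen k) (\<rho> (cen k))"
    "\<And>k. c (cen k) = \<omega> k" "\<And>k. 2 * \<tau> (cen k) \<le> 1 / (real k + 1)"
    "\<forall>z w. (\<forall>a\<in>S. z \<in> cball a (\<rho> a) \<longrightarrow> cmod (w - c a) < 2 * \<tau> a) \<longrightarrow> Omega1_lift z w"
proof -
  define H where "H = {a. a - 1/2 \<in> gauss_ints}"
  \<comment> \<open>Translation by \<open>k\<close> puts the \<open>k\<close>-th point into its own
    translate of \<open>cell\<close>, so \<open>cen\<close> is injective even if data points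
    repeat.\<close>
  define cen where "cen k = (if gdist (\<zeta> k) \<le> 1/8 then of_nat k
      else if gdist (\<zeta> k - 1/2) \<le> 1/8 then 1/2 + of_nat k else \<zeta> k + of_nat k)" for k
  define S where "S = gauss_ints \<union> H \<union> range cen"
  define \<rho> where "\<rho> a = (if a \<in> gauss_ints \<union> H then 1/8 else 0 :: real)" for a
  \<comment> \<open>Discs without data aim at the centre of the corresponding
    \<open>D\<^sub>j\<close>.\<close>
  define c where "c a = (if a \<in> range cen then \<omega> (inv cen a) else if a \<in> gauss_ints then 0 else 1/2)" for a
  \<comment> \<open>Half the room left around \<open>c a\<close> in the admissible disc, and half of
    1 / (k + 1) at the \<open>k\<close>-th centre; the entries 1 stand where no condition
    applies.\<close>
  define \<tau> where "\<tau> a = min (min (if a \<in> gauss_ints then (1/100 - gdist (c a)) / 2 else 1)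
      (if a \<in> H then (1/100 - gdist (c a - 1/2)) / 2 else 1))
      (if a \<in> range cen then 1 / (real (inv cen a) + 1) / 2 else 1)" for a
  have \<tau>_le: "a \<in> gauss_ints \<Longrightarrow> \<tau> a \<le> (1/100 - gdist (c a)) / 2"
    "a \<in> H \<Longrightarrow> \<tau> a \<le> (1/100 - gdist (c a - 1/2)) / 2"
    "a \<in> range cen \<Longrightarrow> \<tau> a \<le> 1 / (real (inv cen a) + 1) / 2" for a
    unfolding \<tau>_def by (simp_all only: if_True min.coboundedI1 min.coboundedI2 order_refl)
  have half: "gdist a = 1/2" if "a \<in> H" for a
    using gdist_cong[of a "1/2"] that gdist_half by (simp add: H_def)
  have GH: "gauss_ints \<inter> H = {}" using half gdist_gauss_ints by fastforce
  have cen_cell: "cen k - of_nat k \<in> cell" for k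
    using cell[of k] by (auto simp: cen_def cell_def)
  have "inj cen"
  proof (rule injI)
    fix k j assume "cen k = cen j"
    then have "real k - 1/4 < real j + 3/4" "real j - 1/4 < real k + 3/4"
      using cen_cell[of k] cen_cell[of j] by (auto simp: cell_def)
    then show "k = j" by linarith
  qed
  then have inv_cen: "inv cen (cen k) = k" for k by simp
  have gdist_shift: "gdist (\<zeta> k + of_nat k) = gdist (\<zeta> k)" "gdist (\<zeta> k + of_nat k - 1/2) = gdist (\<zeta> k - 1/2)" for k
    by (rule gdist_cong, simp)+
  have X: "gdist (cen k) > 1/8 \<and> gdist (cen k - 1/2) > 1/8" if "cen k \<notin> gauss_ints" "cen k \<notin> H" for k
    using that gdist_shift[of k] by (auto simp: cen_def H_def split: if_splits)
  have cenG: "gdist (\<zeta> k) \<le> 1/8" if "cen k \<in> gauss_ints" for k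
  proof (rule ccontr)
    assume n: "\<not> gdist (\<zeta> k) \<le> 1/8"
    have "gdist (cen k) = 0" using that by (rule gdist_gauss_ints)
    moreover have "cen k \<notin> H" using that GH by blast
    ultimately show False using n gdist_shift(1)[of k] by (auto simp: cen_def H_def split: if_splits)
  qed
  have cenH: "gdist (\<zeta> k - 1/2) \<le> 1/8" if "cen k \<in> H" for k
  proof (rule ccontr)
    assume n: "\<not> gdist (\<zeta> k - 1/2) \<le> 1/8"
    have "gdist (cen k - 1/2) = 0" using that by (intro gdist_gauss_ints) (simp add: H_def)
    moreover have "cen k \<notin> gauss_ints" using that GH by blast
    ultimately show False using n gdist_shift(2)[of k] by (auto simp: cen_def split: if_splits)
  qed
  have cG: "gdist (c a) < 1/100" if "a \<in> gauss_ints" for a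
  proof (cases "a \<in> range cen")
    case True
    then obtain k where "a = cen k" by blast
    then show ?thesis using adm[of k] cenG[of k] that by (simp add: c_def inv_cen Omega1_lift_def)
  qed (use that in \<open>simp add: c_def\<close>)
  have cH: "gdist (c a - 1/2) < 1/100" if "a \<in> H" for a
  proof (cases "a \<in> range cen")
    case True
    then obtain k where "a = cen k" by blast
    then show ?thesis using adm[of k] cenH[of k] that by (simp add: c_def inv_cen Omega1_lift_def)
  next
    case False
    moreover have "a \<notin> gauss_ints" using that GH by blast
    ultimately show ?thesis by (simp add: c_def)
  qed
  have sep: "\<rho> a + \<rho> b < cmod (a - b)" if ab: "a \<in> S" "b \<in> S" "a \<noteq> b" for a b
  proof -
    \<comment> \<open>Two such centres differ by a nonzero Gaussian integer or by 1/2 modulo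
      Gaussian integers, so they are at least 1/2 apart.\<close>
    have in_in: "1/8 + 1/8 < cmod (a - b)" if "a \<in> gauss_ints \<union> H" "b \<in> gauss_ints \<union> H" "a \<noteq> b" for a b
    proof -
      have "a - b \<in> gauss_ints \<or> a - b \<in> H \<or> b - a \<in> H"
      proof (cases "a \<in> gauss_ints"; cases "b \<in> gauss_ints")
        assume "a \<in> gauss_ints" "b \<in> gauss_ints"
        then show ?thesis by (simp add: gauss_ints_diff)
      next
        assume "a \<in> gauss_ints" "b \<notin> gauss_ints"
        then show ?thesis using that gauss_ints_diff[of "b - 1/2" a] by (simp add: H_def algebra_simps)
      next
        assume "a \<notin> gauss_ints" "b \<in> gauss_ints"
        then show ?thesis using that gauss_ints_diff[of "a - 1/2" b] by (simp add: H_def algebra_simps)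
      next
        assume "a \<notin> gauss_ints" "b \<notin> gauss_ints"
        then show ?thesis using that gauss_ints_diff[of "a - 1/2" "b - 1/2"] by (simp add: H_def)
      qed
      then consider "a - b \<in> gauss_ints" | "a - b \<in> H \<or> b - a \<in> H" by blast
      then show ?thesis
      proof cases
        case 1
        then show ?thesis using gauss_ints_norm_ge_1[of "a - b"] that(3) by simp
      next
        case 2
        then show ?thesis using half[of "a - b"] half[of "b - a"] gdist_le_norm[of "a - b"] gdist_le_norm[of "b - a"]
          by (auto simp: norm_minus_commute)
      qed
    qed
    have in_out: "1/8 < cmod (a - b)" if h: "a \<in> gauss_ints \<union> H" "b \<in> S" "b \<notin> gauss_ints \<union> H" for a b
    proof -
      obtain k where "b = cen k" using h unfolding S_def by blast
      then have b: "gdist b > 1/8" "gdist (b - 1/2) > 1/8" using X h by auto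
      show ?thesis
      proof (cases "a \<in> gauss_ints")
        case True
        then show ?thesis using b(1) gdist_le[of a b] by (simp add: norm_minus_commute)
      next
        case False
        then have "a - 1/2 \<in> gauss_ints" using h(1) by (simp add: H_def)
        then show ?thesis using b(2) gdist_le[of "a - 1/2" "b - 1/2"] by (simp add: norm_minus_commute)
      qed
    qed
    show ?thesis
      using in_in[of a b] in_out[of a b] in_out[of b a] ab unfolding \<rho>_def
      by (auto simp: norm_minus_commute)
  qed
  show thesis
  proof (rule that[of S \<rho> \<tau> cen c])
    have "infinite (range (of_nat :: nat \<Rightarrow> complex))"
      by (rule range_inj_infinite) (auto intro: inj_of_nat)
    moreover have "range (of_nat :: nat \<Rightarrow> complex) \<subseteq> S" by (auto simp: S_def)
    ultimately show "infinite S" using finite_subset by blast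
    show "finite {a \<in> S. cmod a \<le> R}" for R
    proof -
      have "{a \<in> S. cmod a \<le> R} \<subseteq> {a \<in> gauss_ints. cmod a \<le> R} \<union>
          (+) (1/2) ` {a \<in> gauss_ints. cmod a \<le> R + 1/2} \<union> cen ` {..nat \<lceil>R + 1\<rceil>}"
      proof
        fix a assume "a \<in> {a \<in> S. cmod a \<le> R}"
        then have aR: "cmod a \<le> R" and "a \<in> gauss_ints \<or> a \<in> H \<or> a \<in> range cen" by (auto simp: S_def)
        then consider "a \<in> gauss_ints" | "a \<in> H" | k where "a = cen k" by blast
        then show "a \<in> {a \<in> gauss_ints. cmod a \<le> R} \<union>
          (+) (1/2) ` {a \<in> gauss_ints. cmod a \<le> R + 1/2} \<union> cen ` {..nat \<lceil>R + 1\<rceil>}"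
        proof cases
          case 2
          then have "a - 1/2 \<in> {a \<in> gauss_ints. cmod a \<le> R + 1/2}"
            using aR norm_triangle_ineq4[of a "1/2"] by (simp add: H_def)
          moreover have "a = 1/2 + (a - 1/2)" by simp
          ultimately show ?thesis by blast
        next
          case 3
          \<comment> \<open>\<open>cen k\<close> lies in the \<open>k\<close>-th translate of
            \<open>cell\<close>, so a bound on its real part bounds \<open>k\<close>.\<close>
          have "real k - 1/4 \<le> Re (cen k)" using cen_cell[of k] by (simp add: cell_def)
          also have "\<dots> \<le> R" using aR abs_Re_le_cmod[of "cen k"] 3 by simp
          finally have "k \<le> nat \<lceil>R + 1\<rceil>" by linarith
          then show ?thesis using 3 by blast
        qed (use aR in blast)
      qed
      then show ?thesis by (rule finite_subset) (auto intro: finite_gauss_ints_bounded)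
    qed
    show "0 \<le> \<rho> a" "\<rho> a \<le> 1" for a by (auto simp: \<rho>_def)
    show "disjoint_family_on (\<lambda>a. cball a (\<rho> a)) S"
      unfolding disjoint_family_on_def
    proof (intro ballI impI)
      fix a b assume "a \<in> S" "b \<in> S" "a \<noteq> b"
      then have "\<rho> a + \<rho> b < dist a b" using sep by (simp add: dist_norm)
      then show "cball a (\<rho> a) \<inter> cball b (\<rho> b) = {}" by (rule disjoint_cballI)
    qed
    show "\<forall>a\<in>S. \<tau> a > 0" using cG cH by (auto simp: \<tau>_def)
    show "cen k \<in> S" for k by (simp add: S_def)
    show "\<zeta> k + of_nat k \<in> cball (cen k) (\<rho> (cen k))" for k
    proof -
      consider (G) "gdist (\<zeta> k) \<le> 1/8" | (H) "\<not> gdist (\<zeta> k) \<le> 1/8" "gdist (\<zeta> k - 1/2) \<le> 1/8"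
        | (X) "\<not> gdist (\<zeta> k) \<le> 1/8" "\<not> gdist (\<zeta> k - 1/2) \<le> 1/8" by blast
      then show ?thesis
      proof cases
        case G
        obtain l where l: "l \<in> gauss_ints" "gdist (\<zeta> k) = cmod (\<zeta> k - l)" by (metis gdist_attained)
        then have "l = 0" using G cell[of k] by (intro gauss_int_near_0[of l "\<zeta> k"]) (auto simp: cell_def)
        then have "cmod (\<zeta> k) \<le> 1/8" using l G by simp
        then show ?thesis using G by (simp add: cen_def \<rho>_def dist_norm)
      next
        case H
        obtain l where l: "l \<in> gauss_ints" "gdist (\<zeta> k - 1/2) = cmod (\<zeta> k - 1/2 - l)" by (metis gdist_attained)
        then have "l = 0" using H cell[of k] by (intro gauss_int_near_0[of l "\<zeta> k - 1/2"]) (auto simp: cell_def)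
        then have "cmod (1/2 - \<zeta> k) \<le> 1/8" using l H by (simp add: norm_minus_commute)
        then show ?thesis using H by (simp add: cen_def \<rho>_def H_def dist_norm)
      next
        case X
        then show ?thesis by (simp add: cen_def \<rho>_def)
      qed
    qed
    show "c (cen k) = \<omega> k" for k by (simp add: c_def inv_cen)
    show "2 * \<tau> (cen k) \<le> 1 / (real k + 1)" for k
    proof -
      have "2 * t \<le> x" if "t \<le> x / 2" for t x :: real using that by simp
      from this[OF \<tau>_le(3)[of "cen k"]] show ?thesis by (simp add: inv_cen)
    qed
    have "Omega1_lift z w" if zw: "\<And>a. a \<in> S \<Longrightarrow> z \<in> cball a (\<rho> a) \<Longrightarrow> cmod (w - c a) < 2 * \<tau> a" for z w
      unfolding Omega1_lift_def
    proof (intro conjI impI)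
      assume g: "gdist z \<le> 1/8"
      obtain l where l: "l \<in> gauss_ints" "gdist z = cmod (z - l)" by (metis gdist_attained)
      then have "cmod (w - c l) < 2 * \<tau> l" using g
        by (intro zw) (auto simp: S_def \<rho>_def dist_norm norm_minus_commute)
      moreover have "\<tau> l \<le> (1/100 - gdist (c l)) / 2" using l(1) by (rule \<tau>_le)
      ultimately show "gdist w < 1/100"
        using gdist_add_le[of "w - c l" "c l"] gdist_le_norm[of "w - c l"] by simp
    next
      assume g: "gdist (z - 1/2) \<le> 1/8"
      obtain l where l: "l \<in> gauss_ints" "gdist (z - 1/2) = cmod (z - 1/2 - l)" by (metis gdist_attained)
      define a where "a = 1/2 + l"
      have aH: "a \<in> H" using l by (simp add: H_def a_def)
      have "cmod (z - a) \<le> 1/8" using l g by (simp add: a_def algebra_simps)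
      then have "cmod (w - c a) < 2 * \<tau> a" using aH
        by (intro zw) (auto simp: S_def \<rho>_def dist_norm norm_minus_commute)
      moreover have "\<tau> a \<le> (1/100 - gdist (c a - 1/2)) / 2" using aH by (rule \<tau>_le)
      ultimately show "gdist (w - 1/2) < 1/100"
        using gdist_add_le[of "w - c a" "c a - 1/2"] gdist_le_norm[of "w - c a"] by simp
    qed
    then show "\<forall>z w. (\<forall>a\<in>S. z \<in> cball a (\<rho> a) \<longrightarrow> cmod (w - c a) < 2 * \<tau> a) \<longrightarrow> Omega1_lift z w" by blast
  qed
qed

text \<open>If |t| >= r, dividing M |t|^2 <= D + |v| |t| by |t| gives M r <= D / r + |v|, against
  the third hypothesis.\<close>

lemma quadratic_preimage_small:
  assumes "cmod (v * t + of_real M * t\<^sup>2) \<le> D" "r > 0" "cmod v + D / r < M * r" "M > 0"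
  shows "cmod t < r"
proof (rule ccontr)
  assume "\<not> cmod t < r"
  then have tr: "r \<le> cmod t" by simp
  then have t0: "cmod t > 0" using assms(2) by linarith
  have D0: "0 \<le> D" using assms(1) norm_ge_zero order_trans by blast
  have "M * (cmod t)\<^sup>2 \<le> cmod (v * t + of_real M * t\<^sup>2) + cmod (v * t)"
    using norm_triangle_ineq4[of "v * t + of_real M * t\<^sup>2" "v * t"] assms(4)
    by (simp add: norm_mult norm_power)
  then have "M * (cmod t)\<^sup>2 \<le> D + cmod v * cmod t" using assms(1) by (simp add: norm_mult)
  then have "M * cmod t \<le> D / cmod t + cmod v"
    using t0 by (simp add: field_simps power2_eq_square)
  moreover have "D / cmod t \<le> D / r" using tr assms(2) D0 t0 by (intro divide_left_mono) auto
  moreover have "M * r \<le> M * cmod t" using tr assms(4) by simp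
  ultimately show False using assms(3) by linarith
qed

text \<open>The base coordinate is quadratic rather than linear: for large \<open>M\<close> the component of the
  preimage of a disc that contains 0 is so small that the prescribed second component of the
  derivative does not lead out of the small disc in the fibre.\<close>

lemma curve_through_data:
  fixes \<zeta> \<omega> :: "nat \<Rightarrow> complex"
  assumes cell: "\<And>k. \<zeta> k \<in> cell" and adm: "\<And>k. Omega1_lift (\<zeta> k) (\<omega> k)"
  obtains \<alpha> \<beta> where "\<alpha> holomorphic_on UNIV" "\<beta> holomorphic_on UNIV" "\<alpha> 0 = \<zeta> 0" "\<beta> 0 = \<omega> 0"
    "(\<alpha> has_field_derivative v1) (at 0)" "(\<beta> has_field_derivative v2) (at 0)"
    "\<And>t. Omega1_lift (\<alpha> t) (\<beta> t)" "surj \<alpha>"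
    "\<And>k t. \<alpha> t = \<zeta> k + of_nat k \<Longrightarrow> cmod (\<beta> t - \<omega> k) < 1 / (real k + 1)"
proof -
  obtain S \<rho> \<tau> cen c where S: "infinite S" "\<And>R. finite {a \<in> S. cmod a \<le> R}"
    and \<rho>: "\<And>a. 0 \<le> \<rho> a" "\<And>a. \<rho> a \<le> 1" and disj: "disjoint_family_on (\<lambda>a. cball a (\<rho> a)) S"
    and \<tau>: "\<forall>a\<in>S. \<tau> a > 0"
    and cen: "\<And>k::nat. cen k \<in> S" "\<And>k. \<zeta> k + of_nat k \<in> cball (cen k) (\<rho> (cen k))"
      "\<And>k. c (cen k) = \<omega> k" "\<And>k. 2 * \<tau> (cen k) \<le> 1 / (real k + 1)"
    and S_adm: "\<forall>z w. (\<forall>a\<in>S. z \<in> cball a (\<rho> a) \<longrightarrow> cmod (w - c a) < 2 * \<tau> a) \<longrightarrow> Omega1_lift z w"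
  proof (rule disc_family_through_data[of \<zeta> \<omega>, OF cell adm], goal_cases)
    case (1 S \<rho> \<tau> cen c)
    show ?case by (rule 1(1)[OF 1(2-)])
  qed
  define z0 a0 where "z0 = \<zeta> 0" and "a0 = cen 0"
  have z0: "a0 \<in> S" "z0 \<in> cball a0 (\<rho> a0)" using cen(1)[of 0] cen(2)[of 0] by (simp_all add: z0_def a0_def)
  obtain g where g: "g holomorphic_on UNIV"
    "\<And>a z. a \<in> S \<Longrightarrow> z \<in> cball a (\<rho> a) \<Longrightarrow> cmod (g z - c a) < \<tau> a" "g z0 = c a0"
    using entire_approx_constants_interpolate[OF S \<rho> disj \<tau> z0, of c] by blast
  define g' where "g' = deriv g z0"
  have g': "(g has_field_derivative g') (at z0)"
    unfolding g'_def using g(1) by (simp add: holomorphic_derivI)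
  \<comment> \<open>What \<open>g\<close> after \<open>\<alpha>\<close> still lacks of the
    prescribed derivative \<open>v2\<close> at 0.\<close>
  define c1 where "c1 = v2 - g' * v1"
  define D where "D a = cmod a + 1 + cmod z0" for a
  have D: "cmod (z - z0) \<le> D a" if "z \<in> cball a (\<rho> a)" for z a
    using that \<rho>(2)[of a] norm_triangle_ineq4[of z z0] norm_triangle_ineq2[of z a]
    by (simp add: D_def dist_norm norm_minus_commute)
  \<comment> \<open>Bounds \<open>t\<close> on the preimage of the disc at \<open>a\<close> for
    every \<open>M \<ge> 1\<close>, so it can enter \<open>e\<close> before \<open>M\<close> is
    fixed.\<close>
  define B where "B a = 1 + cmod v1 + D a" for a
  have D1: "D a \<ge> 1" for a by (simp add: D_def)
  have B: "B a \<ge> 1" for a using D1[of a] by (simp add: B_def)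
  \<comment> \<open>\<open>H\<close> has to beat the factor \<open>c1 * t\<close> on every disc but
    that of \<open>a0\<close>; the 1 added to \<open>cmod c1\<close> covers \<open>c1 = 0\<close>
    and makes the estimate strict.\<close>
  define e where "e a = min 1 (\<tau> a / ((cmod c1 + 1) * B a))" for a
  have c1_pos: "cmod c1 + 1 > 0" by (simp add: add_nonneg_pos)
  have e: "\<forall>a\<in>S. e a > 0"
  proof
    fix a assume "a \<in> S"
    then show "e a > 0" using \<tau> c1_pos B[of a] by (simp add: e_def)
  qed
  obtain H where H: "H holomorphic_on UNIV"
    "\<And>a z. a \<in> S \<Longrightarrow> z \<in> cball a (\<rho> a) \<Longrightarrow> cmod (H z - (if a = a0 then 1 else 0)) < e a"
    "H z0 = (if a0 = a0 then 1 else 0)"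
    using entire_approx_constants_interpolate[OF S \<rho> disj e z0, of "\<lambda>a. if a = a0 then 1 else 0"] by blast
  have H0: "H z0 = 1" using H(3) by simp
  obtain H' where H': "(H has_field_derivative H') (at z0)"
    using H(1) by (metis UNIV_I holomorphic_derivI open_UNIV)
  \<comment> \<open>On the disc of \<open>a0\<close>, \<open>H\<close> is close to 1 and bounded
    only by 2, so \<open>t\<close> itself must be small:
    \<open>2 * (cmod c1 + 1) * r = \<tau> a0\<close>.\<close>
  define r where "r = \<tau> a0 / (2 * (cmod c1 + 1))"
  have r: "r > 0" using \<tau> z0(1) c1_pos by (simp add: r_def)
  \<comment> \<open>Makes \<open>M * r\<close> equal to \<open>r + cmod v1 + D a0 / r\<close>, above
    the bound required for \<open>cmod t < r\<close>.\<close>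
  define M where "M = 1 + (cmod v1 + D a0 / r) / r"
  have Dr: "D a0 / r \<ge> 0" using D1[of a0] r by simp
  then have M1: "M \<ge> 1" using r by (simp add: M_def)
  have Mr: "cmod v1 + D a0 / r < M * r" 
  proof -
    have "(1 + x / r) * r = r + x" for x using r by (simp add: distrib_right)
    then show ?thesis using r unfolding M_def by simp
  qed
  define \<alpha> where "\<alpha> t = z0 + (v1 * t + of_real M * t\<^sup>2)" for t
  \<comment> \<open>The added term vanishes at 0 and has derivative \<open>c1\<close> there because
    \<open>H z0 = 1\<close>, so value and derivative are both met.\<close>
  define \<beta> where "\<beta> t = g (\<alpha> t) + c1 * t * H (\<alpha> t)" for t
  have t_a0: "cmod t < r" if "\<alpha> t \<in> cball a0 (\<rho> a0)" for t
    using D[OF that] r Mr M1 by (intro quadratic_preimage_small[of v1 t M "D a0"]) (auto simp: \<alpha>_def)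
  have t_B: "cmod t \<le> B a" if "\<alpha> t \<in> cball a (\<rho> a)" for t a
  proof (rule less_imp_le, rule quadratic_preimage_small[of v1 t M "D a"])
    show "cmod (v1 * t + of_real M * t\<^sup>2) \<le> D a" using D[OF that] by (simp add: \<alpha>_def)
    have "D a / B a \<le> D a" using D1[of a] B[of a] by (simp add: divide_le_eq mult_le_cancel_left1)
    moreover have "1 * B a \<le> M * B a" using M1 B[of a] by (intro mult_right_mono) auto
    ultimately show "cmod v1 + D a / B a < M * B a" by (simp add: B_def)
  qed (use B[of a] M1 in auto)
  have corr: "cmod (c1 * t * H (\<alpha> t)) < \<tau> a" if aS: "a \<in> S" and mem: "\<alpha> t \<in> cball a (\<rho> a)" for a t
  proof (cases "a = a0")
    case True
    have "cmod (H (\<alpha> t) - 1) < 1" using H(2)[OF aS mem] True by (simp add: e_def)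
    then have "cmod (H (\<alpha> t)) \<le> 2" using norm_triangle_ineq[of "H (\<alpha> t) - 1" 1] by simp
    then have "cmod (c1 * t * H (\<alpha> t)) \<le> cmod c1 * r * 2"
      unfolding norm_mult using t_a0[of t] mem True r by (intro mult_mono) auto
    also have "\<dots> < (cmod c1 + 1) * r * 2" using r by simp
    also have "x * (y / (2 * x)) * 2 = y" if "x > 0" for x y :: real using that by simp
    then have "(cmod c1 + 1) * r * 2 = \<tau> a0" unfolding r_def using c1_pos by blast
    finally show ?thesis using True by simp
  next
    case False
    have "cmod (H (\<alpha> t)) < e a" using H(2)[OF aS mem] False by simp
    moreover have "e a \<le> \<tau> a / ((cmod c1 + 1) * B a)" by (simp add: e_def)
    ultimately have "cmod (H (\<alpha> t)) \<le> \<tau> a / ((cmod c1 + 1) * B a)" by linarith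
    then have "cmod (c1 * t * H (\<alpha> t)) \<le> cmod c1 * B a * (\<tau> a / ((cmod c1 + 1) * B a))"
      unfolding norm_mult using t_B[OF mem] order_trans[OF zero_le_one B[of a]] by (intro mult_mono mult_nonneg_nonneg) auto
    also have "x * y * (u / (s * y)) = u * (x / s)" if "y \<ge> 1" for x y u s :: real using that by simp
    then have "cmod c1 * B a * (\<tau> a / ((cmod c1 + 1) * B a)) = \<tau> a * (cmod c1 / (cmod c1 + 1))"
      using B[of a] by blast
    also have "\<dots> < \<tau> a * 1" using \<tau> aS c1_pos by (intro mult_strict_left_mono) auto
    finally show ?thesis by simp
  qed
  have close: "cmod (\<beta> t - c a) < 2 * \<tau> a" if "a \<in> S" "\<alpha> t \<in> cball a (\<rho> a)" for a t
    using norm_triangle_ineq[of "g (\<alpha> t) - c a" "c1 * t * H (\<alpha> t)"] corr[OF that] g(2)[OF that]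
    by (simp add: \<beta>_def algebra_simps)
  have hol\<alpha>: "\<alpha> holomorphic_on UNIV" unfolding \<alpha>_def by (intro holomorphic_intros)
  have "(\<lambda>t. g (\<alpha> t)) holomorphic_on UNIV" "(\<lambda>t. H (\<alpha> t)) holomorphic_on UNIV"
    using holomorphic_on_compose[OF hol\<alpha>, of g] holomorphic_on_compose[OF hol\<alpha>, of H] g(1) H(1)
    by (auto simp: o_def intro: holomorphic_on_subset)
  then have hol\<beta>: "\<beta> holomorphic_on UNIV" unfolding \<beta>_def by (intro holomorphic_intros)
  have \<alpha>0: "\<alpha> 0 = z0" by (simp add: \<alpha>_def)
  have d\<alpha>: "(\<alpha> has_field_derivative v1) (at 0)"
    unfolding \<alpha>_def by (auto intro!: derivative_eq_intros)
  have "((\<lambda>t. g (\<alpha> t)) has_field_derivative g' * v1) (at 0)"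
    using DERIV_chain2[of g g' \<alpha> 0 v1 UNIV] g' d\<alpha> \<alpha>0 by simp
  moreover have dH: "((\<lambda>t. H (\<alpha> t)) has_field_derivative H' * v1) (at 0)"
    using DERIV_chain2[of H H' \<alpha> 0 v1 UNIV] H' d\<alpha> \<alpha>0 by simp
  have "((\<lambda>t. c1 * t * H (\<alpha> t)) has_field_derivative c1) (at 0)"
    by (rule derivative_eq_intros dH refl)+ (simp add: \<alpha>0 H0)
  ultimately have "((\<lambda>t. g (\<alpha> t) + c1 * t * H (\<alpha> t)) has_field_derivative g' * v1 + c1) (at 0)"
    by (rule DERIV_add)
  then have d\<beta>: "(\<beta> has_field_derivative v2) (at 0)"
    unfolding \<beta>_def c1_def by simp
  \<comment> \<open>The quadratic can be solved for every \<open>v1\<close>, including 0, since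
    \<open>M\<close> is nonzero.\<close>
  have surj: "surj \<alpha>"
    unfolding surj_def
  proof
    fix y
    define s where "s = csqrt (v1\<^sup>2 - 4 * of_real M * (z0 - y))"
    have s2: "s\<^sup>2 = v1\<^sup>2 - 4 * of_real M * (z0 - y)" by (simp add: s_def)
    have M0: "complex_of_real M \<noteq> 0" using M1 by simp
    have "\<alpha> ((s - v1) / (2 * of_real M)) = z0 + (s\<^sup>2 - v1\<^sup>2) / (4 * of_real M)"
      using M0 by (simp add: \<alpha>_def field_simps power2_eq_square)
    also have "\<dots> = y" unfolding s2 using M0 by (simp add: field_simps)
    finally show "\<exists>x. y = \<alpha> x" by metis
  qed
  show thesis
  proof (rule that[OF hol\<alpha> hol\<beta> _ _ d\<alpha> d\<beta> _ surj])
    show "\<alpha> 0 = \<zeta> 0" by (simp add: \<alpha>0 z0_def)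
    show "\<beta> 0 = \<omega> 0" using g(3) cen(3)[of 0] by (simp add: \<beta>_def \<alpha>0 a0_def)
    show "Omega1_lift (\<alpha> t) (\<beta> t)" for t using S_adm close by blast
    show "cmod (\<beta> t - \<omega> k) < 1 / (real k + 1)" if "\<alpha> t = \<zeta> k + of_nat k" for k t
      using close[of "cen k" t] cen(1,2,3,4)[of k] that by simp
  qed
qed

section \<open>Curves in the torus and their closures\<close>

lemma holomorphic_lift_vec2:
  assumes "\<alpha> holomorphic_on UNIV" "\<beta> holomorphic_on UNIV"
  shows "holomorphic_lift 2 lat2 (\<lambda>t. proj2 (\<alpha> t) (\<beta> t)) UNIV (\<lambda>t. vec2 (\<alpha> t) (\<beta> t))"
  unfolding holomorphic_lift_def
proof (intro conjI allI ballI)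
  fix i show "(\<lambda>z. vec2 (\<alpha> z) (\<beta> z) i) holomorphic_on UNIV"
    using assms unfolding vec2_def by (cases "i = 0"; cases "i = 1") auto
qed (auto simp: proj2_def)

text \<open>The data run through a countable dense set of representatives of \<open>Omega1\<close>
  over \<open>cell\<close>, each infinitely often, so that the tolerances 1 / (k + 1) become
  arbitrarily small at it. Surjectivity of \<open>\<alpha>\<close> realises every base
  value.\<close>

lemma dense_curve_in_Omega1:
  assumes p: "p \<in> Omega1" and v: "v \<in> Cn 2"
  shows "\<exists>f. torus_holomorphic 2 lat2 f \<and> range f \<subseteq> Omega1 \<and> \<not> f constant_on UNIV \<and> f 0 = p \<and>
    has_torus_derivative 2 lat2 f v 0 \<and>
    torus_topology 2 lat2 closure_of range f = torus_topology 2 lat2 closure_of Omega1"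
proof -
  define W where "W = {q. fst q \<in> cell \<and> Omega1_lift (fst q) (snd q)}"
  have repr: "\<exists>z w. q = proj2 z w \<and> (z, w) \<in> W" if "q \<in> Omega1" for q
  proof -
    obtain z w where zw: "q = proj2 z w" using \<open>q \<in> Omega1\<close> by (auto simp: Omega1_def)
    obtain l where l: "l \<in> gauss_ints" "z - l \<in> cell" using cell_representative by blast
    have "q = proj2 (z - l) w" using zw l by (simp add: proj2_eq_iff)
    moreover have "Omega1_lift (z - l) w" using \<open>q \<in> Omega1\<close> \<open>q = proj2 (z - l) w\<close> proj2_in_Omega1_iff by blast
    ultimately show ?thesis using l unfolding W_def by auto
  qed
  obtain z0 w0 where p0: "p = proj2 z0 w0" "(z0, w0) \<in> W" using repr[OF p] by blast
  obtain E where E: "countable E" "E \<subseteq> W" "W \<subseteq> closure E" using separable by blast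
  have "E \<noteq> {}" using E(3) p0(2) by auto
  \<comment> \<open>Index 0 carries \<open>p\<close>, where the curve has to start; the first
    component of the decoded pair repeats each element of \<open>E\<close> infinitely often.\<close>
  define q where "q k = (if k = 0 then (z0, w0) else from_nat_into E (fst (prod_decode k)))" for k
  have q: "q k \<in> W" for k using p0(2) from_nat_into[OF \<open>E \<noteq> {}\<close>] E(2) unfolding q_def by auto
  obtain \<alpha> \<beta> where \<alpha>\<beta>: "\<alpha> holomorphic_on UNIV" "\<beta> holomorphic_on UNIV" "\<alpha> 0 = fst (q 0)" "\<beta> 0 = snd (q 0)"
    "(\<alpha> has_field_derivative v 0) (at 0)" "(\<beta> has_field_derivative v 1) (at 0)"
    "\<And>t. Omega1_lift (\<alpha> t) (\<beta> t)" "surj \<alpha>"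
    "\<And>k t. \<alpha> t = fst (q k) + of_nat k \<Longrightarrow> cmod (\<beta> t - snd (q k)) < 1 / (real k + 1)"
  proof (rule curve_through_data[of "\<lambda>k. fst (q k)" "\<lambda>k. snd (q k)" "v 0" "v 1"])
    show "fst (q k) \<in> cell" "Omega1_lift (fst (q k)) (snd (q k))" for k using q[of k] by (auto simp: W_def)
  qed blast
  define f where "f t = proj2 (\<alpha> t) (\<beta> t)" for t
  have lift: "holomorphic_lift 2 lat2 f UNIV (\<lambda>t. vec2 (\<alpha> t) (\<beta> t))"
    unfolding f_def using holomorphic_lift_vec2 \<alpha>\<beta>(1,2) by blast
  have rng: "range f \<subseteq> Omega1" using \<alpha>\<beta>(7) by (auto simp: f_def proj2_in_Omega1_iff)
  have f0: "f 0 = p" using \<alpha>\<beta>(3,4) p0 by (simp add: f_def q_def)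
  have hol: "torus_holomorphic 2 lat2 f" unfolding torus_holomorphic_def using lift by blast
  have "((\<lambda>w. vec2 (\<alpha> w) (\<beta> w) i) has_field_derivative v i) (at 0)" for i
  proof -
    consider "i = 0" | "i = 1" | "i \<ge> 2" by linarith
    then show ?thesis
    proof cases
      case 3
      then have "v i = 0" "\<And>w. vec2 (\<alpha> w) (\<beta> w) i = 0" using v by (auto simp: Cn_def vec2_def)
      then show ?thesis by simp
    qed (use \<alpha>\<beta>(5,6) in simp_all)
  qed
  then have der: "has_torus_derivative 2 lat2 f v 0" unfolding has_torus_derivative_def using lift by blast
  have nc: "\<not> f constant_on UNIV"
  proof
    assume const: "f constant_on UNIV"
    obtain t where t: "\<alpha> t = \<alpha> 0 + 1/2" using \<alpha>\<beta>(8) by (metis surjD)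
    have "f t = f 0" using const unfolding constant_on_def by auto
    then have "1/2 \<in> gauss_ints" using t by (simp add: f_def proj2_eq_iff)
    then show False using gdist_gauss_ints gdist_half by fastforce
  qed
  have "Omega1 \<subseteq> torus_topology 2 lat2 closure_of range f"
  proof
    fix y assume "y \<in> Omega1"
    then obtain z w where zw: "y = proj2 z w" "(z, w) \<in> W" using repr by blast
    have "(z, w) \<in> closure {p. proj2 (fst p) (snd p) \<in> range f}"
      unfolding closure_approachable
    proof (intro allI impI)
      fix d :: real assume "d > 0"
      obtain z' w' where zw': "(z', w') \<in> E" "dist (z', w') (z, w) < d / 2"
        using zw(2) E(3) \<open>d > 0\<close> closure_approachable[of "(z, w)" E] half_gt_zero[of d]
        by (metis subsetD surj_pair)
      obtain i where i: "from_nat_into E i = (z', w')" using zw'(1) E(1) from_nat_into_surj by metis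
      obtain j :: nat where j: "1 / (real j + 1) < d / 2"
        using reals_Archimedean[of "d / 2"] \<open>d > 0\<close> by (auto simp: inverse_eq_divide add.commute)
      \<comment> \<open>\<open>Suc j\<close> makes \<open>k\<close> positive, off the reserved index
        0, and large enough for the tolerance.\<close>
      define k where "k = prod_encode (i, Suc j)"
      have kj: "k \<ge> Suc j" unfolding k_def by (rule le_prod_encode_2)
      then have qk: "q k = (z', w')" using i by (simp add: q_def k_def)
      \<comment> \<open>The integer shift that separates the data in C^2 disappears in the
        torus.\<close>
      obtain t where t: "\<alpha> t = z' + of_nat k" using \<alpha>\<beta>(8) by (metis surjD)
      have "cmod (\<beta> t - w') < 1 / (real k + 1)" using \<alpha>\<beta>(9)[of t k] t qk by simp
      also have "\<dots> \<le> 1 / (real j + 1)" using kj by (intro divide_left_mono) auto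
      also have "\<dots> < d / 2" by (rule j)
      finally have "dist (z', \<beta> t) (z', w') < d / 2" by (simp add: dist_Pair_Pair dist_norm)
      then have "dist (z', \<beta> t) (z, w) < d" using zw'(2) dist_triangle_half_r[of "(z', w')" "(z', \<beta> t)" d "(z, w)"]
        by (simp add: dist_commute)
      moreover have "proj2 z' (\<beta> t) = f t" unfolding f_def t by (simp add: proj2_eq_iff)
      ultimately show "\<exists>y\<in>{p. proj2 (fst p) (snd p) \<in> range f}. dist y (z, w) < d"
        by (intro bexI[of _ "(z', \<beta> t)"]) auto
    qed
    then show "y \<in> torus_topology 2 lat2 closure_of range f" unfolding zw(1) by (rule proj2_in_closure_ofI)
  qed
  then have "torus_topology 2 lat2 closure_of range f = torus_topology 2 lat2 closure_of Omega1"
    using rng by (intro subset_antisym closure_of_mono closure_of_minimal) auto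
  then show ?thesis using hol rng nc f0 der by blast
qed

theorem theorem2:
  shows "\<exists>(n::nat) (\<Lambda>::cvec set) (h::cvec set \<Rightarrow> cvec \<Rightarrow> cvec \<Rightarrow> complex)
            (\<Omega>\<^sub>1::cvec set set) (\<Omega>\<^sub>2::cvec set set).
    complex_lattice n \<Lambda> \<and> flat_hermitian_metric n \<Lambda> h \<and>
    openin (torus_topology n \<Lambda>) \<Omega>\<^sub>1 \<and> openin (torus_topology n \<Lambda>) \<Omega>\<^sub>2 \<and> \<Omega>\<^sub>2 \<subseteq> \<Omega>\<^sub>1 \<and>
    (subtopology (torus_topology n \<Lambda>) \<Omega>\<^sub>1) closure_of \<Omega>\<^sub>2 \<noteq> \<Omega>\<^sub>1 \<and>
    torus_topology n \<Lambda> closure_of \<Omega>\<^sub>1 \<noteq> torus n \<Lambda> \<and>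
    (\<forall>p\<in>\<Omega>\<^sub>1. \<forall>v\<in>Cn n. \<exists>f::complex \<Rightarrow> cvec set.
        torus_holomorphic n \<Lambda> f \<and> range f \<subseteq> \<Omega>\<^sub>1 \<and> \<not> f constant_on UNIV \<and>
        f 0 = p \<and> has_torus_derivative n \<Lambda> f v 0 \<and>
        torus_topology n \<Lambda> closure_of range f = torus_topology n \<Lambda> closure_of \<Omega>\<^sub>1) \<and>
    (\<forall>f::complex \<Rightarrow> cvec set.
        torus_holomorphic n \<Lambda> f \<and> \<not> f constant_on UNIV \<and> bounded_torus_derivative n \<Lambda> h f \<and>
        range f \<subseteq> torus_topology n \<Lambda> closure_of \<Omega>\<^sub>1 \<longrightarrow>
        range f \<subseteq> torus_topology n \<Lambda> closure_of \<Omega>\<^sub>2 \<and>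
        torus_affine_linear n \<Lambda> f \<and>
        torus_closed_analytic n \<Lambda> (torus_topology n \<Lambda> closure_of range f))"
proof (rule exI[of _ 2], rule exI[of _ lat2], rule exI[of _ "\<lambda>_. Cn_inner 2"], rule exI[of _ Omega1],
    rule exI[of _ Omega2], intro conjI ballI)
  show "\<forall>f. torus_holomorphic 2 lat2 f \<and> \<not> f constant_on UNIV \<and>
        bounded_torus_derivative 2 lat2 (\<lambda>_. Cn_inner 2) f \<and>
        range f \<subseteq> torus_topology 2 lat2 closure_of Omega1 \<longrightarrow>
        range f \<subseteq> torus_topology 2 lat2 closure_of Omega2 \<and> torus_affine_linear 2 lat2 f \<and>
        torus_closed_analytic 2 lat2 (torus_topology 2 lat2 closure_of range f)"
  proof (intro allI impI, elim conjE)
    fix f assume f: "torus_holomorphic 2 lat2 f" "\<not> f constant_on UNIV"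
      "bounded_torus_derivative 2 lat2 (\<lambda>_. Cn_inner 2) f"
      "range f \<subseteq> torus_topology 2 lat2 closure_of Omega1"
    have aff: "torus_affine_linear 2 lat2 f" using f(1,3) by (rule bounded_torus_derivative_imp_affine)
    obtain a where a: "range f = {proj2 a w | w. True}" "gdist a \<ge> 1/8" "gdist (a - 1/2) \<ge> 1/8"
      using affine_in_closure_Omega1[OF aff f(2,4)] .
    \<comment> \<open>The curve is a whole fibre and already closed, so analyticity of the fibre is
      analyticity of the closure.\<close>
    have "closedin (torus_topology 2 lat2) (range f)"
      using torus_closed_analytic_vertical[of a] by (simp add: a(1) torus_closed_analytic_def)
    then have "torus_topology 2 lat2 closure_of range f = range f" by (rule closure_of_closedin)
    moreover have "range f \<subseteq> torus_topology 2 lat2 closure_of Omega2"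
      using vertical_in_closure_Omega2[OF a(2,3)] unfolding a(1) by blast
    ultimately show "range f \<subseteq> torus_topology 2 lat2 closure_of Omega2 \<and> torus_affine_linear 2 lat2 f \<and>
        torus_closed_analytic 2 lat2 (torus_topology 2 lat2 closure_of range f)"
      using aff torus_closed_analytic_vertical[of a] by (simp add: a(1))
  qed
qed (simp_all add: complex_lattice_lat2 flat_hermitian_metric_def openin_Omega1 openin_Omega2
    Omega2_subset_Omega1 Omega2_not_dense Omega1_not_dense dense_curve_in_Omega1)

end
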